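(* Let $R$ be a Prüfer domain, and suppose that $R$ is either (a) semilocal; or (b) locally finite and finite-dimensional. Let $\ast$ be a star operation on $R$. Then $$G_\ast(R)\simeq\bigoplus_{\substack{M\in\mathrm{Max}(R)\\ M\neq M^\ast}}\mathrm{Cl}^v(R_M).$$
   Context: For an integral domain $R$ with quotient field $K$, $\mathcal{F}(R)$ is the set of fractional ideals of $R$ (the $R$-submodules $I$ of $K$ with $dI\subseteq R$ for some nonzero $d\in R$). A star operation on $R$ is a map $\ast:\mathcal{F}(R)\to\mathcal{F}(R)$, $I\mapsto I^\ast$, such that for all $I,J\in\mathcal{F}(R)$, $x\in K$: $I\subseteq I^\ast$; $(I^\ast)^\ast=I^\ast$; $I\subseteq J$ implies $I^\ast\subseteq J^\ast$; $R^\ast=R$; $(xI)^\ast=xI^\ast$. The $v$-operation is $I\mapsto I^v=(R:(R:I))$ and the identity star operation is denoted by $d$; here $(I:J)=\{x\in K\mid xJ\subseteq I\}$. A fractional ideal $I$ is $\ast$-invertible if $(I(R:I))^\ast=R$. The set $\mathrm{Inv}^\ast(R)$ of $\ast$-invertible fractional ideals $I$ with $I=I^\ast$ is a group under $(I,J)\mapsto(IJ)^\ast$; it contains the subgroup $\mathrm{Prin}(R)$ of nonzero principal fractional ideals. The $\ast$-class group is $\mathrm{Cl}^\ast(R)=\mathrm{Inv}^\ast(R)/\mathrm{Prin}(R)$, the Picard group is $\mathrm{Pic}(R)=\mathrm{Cl}^d(R)$ (a subgroup of $\mathrm{Cl}^\ast(R)$), and the $\ast$-local class group is $G_\ast(R)=\mathrm{Cl}^\ast(R)/\mathrm{Pic}(R)$.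 In $\mathrm{Cl}^v(R_M)$, $v$ denotes the $v$-operation of the domain $R_M$. $R$ is locally finite (of finite character) if every nonzero $x\in R$ is contained in only finitely many maximal ideals of $R$; semilocal means having finitely many maximal ideals. *)

theory Defs
  imports "HOL-Algebra.Algebra" "HOL-Library.Extended_Nat"
begin

text \<open>
  An integral domain is given as a subring \<open>R\<close> of its quotient field \<open>K\<close>; as a ring in its own
  right it is \<open>K\<lparr>carrier := R\<rparr>\<close>. In this way \<open>R\<close>, its fractional ideals, its localizations and
  their fractional ideals are all subsets of the one field \<open>K\<close>.
\<close>

definition domain_with_quotient_field :: "('a, 'm) ring_scheme \<Rightarrow> 'a set \<Rightarrow> bool"
  where "domain_with_quotient_field K R \<longleftrightarrow>
    field K \<and> subring R K \<and>
    carrier K = {a \<otimes>\<^bsub>K\<^esub> inv\<^bsub>K\<^esub> b | a b. a \<in> R \<and> b \<in> R - {\<zero>\<^bsub>K\<^esub>}}"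

definition Max_spec :: "('a, 'm) ring_scheme \<Rightarrow> 'a set \<Rightarrow> 'a set set"
  where "Max_spec K R = {M. maximalideal M (K\<lparr>carrier := R\<rparr>)}"

definition localization :: "('a, 'm) ring_scheme \<Rightarrow> 'a set \<Rightarrow> 'a set \<Rightarrow> 'a set"
  where "localization K R P = {a \<otimes>\<^bsub>K\<^esub> inv\<^bsub>K\<^esub> s | a s. a \<in> R \<and> s \<in> R - P}"

definition krull_dim :: "('a, 'm) ring_scheme \<Rightarrow> enat"
  where "krull_dim A = Sup {enat n | n. \<exists>P :: nat \<Rightarrow> 'a set.
    (\<forall>i\<le>n. primeideal (P i) A) \<and> (\<forall>i<n. P i \<subset> P (Suc i))}"

definition semilocal :: "('a, 'm) ring_scheme \<Rightarrow> 'a set \<Rightarrow> bool"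
  where "semilocal K R \<longleftrightarrow> finite (Max_spec K R)"

definition locally_finite :: "('a, 'm) ring_scheme \<Rightarrow> 'a set \<Rightarrow> bool"
  where "locally_finite K R \<longleftrightarrow>
    (\<forall>x \<in> R - {\<zero>\<^bsub>K\<^esub>}. finite {M \<in> Max_spec K R. x \<in> M})"

definition finite_dimensional :: "('a, 'm) ring_scheme \<Rightarrow> 'a set \<Rightarrow> bool"
  where "finite_dimensional K R \<longleftrightarrow> krull_dim (K\<lparr>carrier := R\<rparr>) < \<infinity>"


text \<open>
  The library locale \<open>subalgebra R I K\<close> says that \<open>I\<close> is an additive subgroup of \<open>K\<close> closed under
  multiplication by elements of \<open>R\<close>, that is, an \<open>R\<close>-submodule of \<open>K\<close>. The zero ideal counts as
  a fractional ideal.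
\<close>

definition fractional_ideals :: "('a, 'm) ring_scheme \<Rightarrow> 'a set \<Rightarrow> 'a set set"
  where "fractional_ideals K R =
    {I. subalgebra R I K \<and> (\<exists>d \<in> R - {\<zero>\<^bsub>K\<^esub>}. d <#\<^bsub>K\<^esub> I \<subseteq> R)}"

definition colon :: "('a, 'm) ring_scheme \<Rightarrow> 'a set \<Rightarrow> 'a set \<Rightarrow> 'a set"
  where "colon K I J = {x \<in> carrier K. x <#\<^bsub>K\<^esub> J \<subseteq> I}"

definition star_operation :: "('a, 'm) ring_scheme \<Rightarrow> 'a set \<Rightarrow> ('a set \<Rightarrow> 'a set) \<Rightarrow> bool"
  where "star_operation K R star \<longleftrightarrow>
    star \<in> fractional_ideals K R \<rightarrow> fractional_ideals K R \<and>
    (\<forall>I \<in> fractional_ideals K R. I \<subseteq> star I) \<and>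
    (\<forall>I \<in> fractional_ideals K R. star (star I) = star I) \<and>
    (\<forall>I \<in> fractional_ideals K R. \<forall>J \<in> fractional_ideals K R. I \<subseteq> J \<longrightarrow> star I \<subseteq> star J) \<and>
    star R = R \<and>
    (\<forall>I \<in> fractional_ideals K R. \<forall>x \<in> carrier K. star (x <#\<^bsub>K\<^esub> I) = x <#\<^bsub>K\<^esub> star I)"

definition d_op :: "'a set \<Rightarrow> 'a set"
  where "d_op I = I"

definition v_op :: "('a, 'm) ring_scheme \<Rightarrow> 'a set \<Rightarrow> 'a set \<Rightarrow> 'a set"
  where "v_op K R I = colon K R (colon K R I)"


text \<open>
  \<open>I \<cdot>\<^bsub>K\<^esub> J\<close> is the set of all finite sums of products of an element of \<open>I\<close> and an element
  of \<open>J\<close>; for \<open>R\<close>-submodules \<open>I\<close>, \<open>J\<close> of \<open>K\<close> it is their product as \<open>R\<close>-modules.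
\<close>

definition star_invertible ::
    "('a, 'm) ring_scheme \<Rightarrow> 'a set \<Rightarrow> ('a set \<Rightarrow> 'a set) \<Rightarrow> 'a set \<Rightarrow> bool"
  where "star_invertible K R star I \<longleftrightarrow> star (I \<cdot>\<^bsub>K\<^esub> colon K R I) = R"

definition Inv_star ::
    "('a, 'm) ring_scheme \<Rightarrow> 'a set \<Rightarrow> ('a set \<Rightarrow> 'a set) \<Rightarrow> 'a set monoid"
  where "Inv_star K R star =
    \<lparr>carrier = {I \<in> fractional_ideals K R. star_invertible K R star I \<and> I = star I},
     monoid.mult = (\<lambda>I J. star (I \<cdot>\<^bsub>K\<^esub> J)),
     one = R\<rparr>"

definition Prin :: "('a, 'm) ring_scheme \<Rightarrow> 'a set \<Rightarrow> 'a set set"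
  where "Prin K R = {x <#\<^bsub>K\<^esub> R | x. x \<in> carrier K - {\<zero>\<^bsub>K\<^esub>}}"

definition Cl_star ::
    "('a, 'm) ring_scheme \<Rightarrow> 'a set \<Rightarrow> ('a set \<Rightarrow> 'a set) \<Rightarrow> 'a set set monoid"
  where "Cl_star K R star = Inv_star K R star Mod Prin K R"

definition Pic :: "('a, 'm) ring_scheme \<Rightarrow> 'a set \<Rightarrow> 'a set set monoid"
  where "Pic K R = Cl_star K R d_op"

text \<open>
  The class of an invertible ideal \<open>I\<close> is the set of all \<open>xI\<close> with \<open>x \<noteq> 0\<close>, both in the Picard
  group and in the class group of a star operation, so that the carrier of the former is literally
  a subset of the carrier of the latter and the quotient below needs no embedding.
\<close>

definition local_class_group ::
    "('a, 'm) ring_scheme \<Rightarrow> 'a set \<Rightarrow> ('a set \<Rightarrow> 'a set) \<Rightarrow> 'a set set set monoid"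
  where "local_class_group K R star = Cl_star K R star Mod carrier (Pic K R)"

definition prufer_domain :: "('a, 'm) ring_scheme \<Rightarrow> 'a set \<Rightarrow> bool"
  where "prufer_domain K R \<longleftrightarrow> domain_with_quotient_field K R \<and>
    (\<forall>S. finite S \<and> S \<subseteq> R \<and> genideal (K\<lparr>carrier := R\<rparr>) S \<noteq> {\<zero>\<^bsub>K\<^esub>} \<longrightarrow>
      star_invertible K R d_op (genideal (K\<lparr>carrier := R\<rparr>) S))"

end

theory Submission
  imports Defs
begin

text \<open>
  An ideal \<open>I\<close> in \<open>Inv\<^sup>*(R)\<close> is sent to the family of classes of \<open>(I R\<^sub>M)\<^sup>v\<close>, where \<open>M\<close> runs through
  the maximal ideals with \<open>M \<noteq> M\<^sup>*\<close>, that is, \<open>M\<^sup>* = R\<close>. By finite character, for a maximal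
  ideal \<open>M \<noteq> 0\<close> there is \<open>w \<in> K\<close> that lies in \<open>R\<^sub>N\<close> for
  every maximal \<open>N \<noteq> M\<close> but not in \<open>R\<^sub>M\<close>: it is an element of the inverse of a finitely generated
  ideal contained in \<open>M\<close> and in no other maximal ideal.

  Multiplicativity: if \<open>(R : A) = R\<close> then \<open>(R\<^sub>M : A) \<subseteq> R\<^sub>M\<close> for every \<open>M\<close>; apply this to \<open>A = I (R : I)\<close>.
  Kernel: if \<open>(I R\<^sub>M)\<^sup>v = x R\<^sub>M\<close> and \<open>M\<^sup>* = R\<close>, then \<open>w\<close> provides a multiple \<open>z\<close> of \<open>x\<close> by a unit of
  \<open>R\<^sub>M\<close> with \<open>z M \<subseteq> I\<close>, so that \<open>z \<in> I\<^sup>* = I\<close>; hence \<open>I\<close> and \<open>(R : I)\<close> are principal at \<open>M\<close>, with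
  product \<open>R\<^sub>M\<close>. At a maximal ideal with \<open>M = M\<^sup>*\<close>, star-invertibility already says that \<open>I (R : I)\<close>
  is not contained in \<open>M\<close>. Surjectivity: a v-invertible v-ideal \<open>L\<close> of \<open>R\<^sub>M\<close> can be
  scaled so that \<open>1 \<in> L \<subseteq> w R\<^sub>M\<close>, and then \<open>I = L \<inter> \<Inter>\<^bsub>N \<noteq> M\<^esub> R\<^sub>N\<close> satisfies \<open>M \<subseteq> I (R : I)\<close>,
  \<open>I R\<^sub>M = L\<close> and \<open>I R\<^sub>N = R\<^sub>N\<close> for \<open>N \<noteq> M\<close>.
\<close>

section \<open>Domains in their quotient field and groups of star-invertible ideals\<close>

locale qdomain = field K for K :: "('a, 'm) ring_scheme" (structure) +
  fixes R :: "'a set"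
  assumes subring_R: "subring R K"
    and carrier_quot: "carrier K = {a \<otimes> inv b | a b. a \<in> R \<and> b \<in> R - {\<zero>}}"
begin

section \<open>Arithmetic in \<open>K\<close> and denominators in \<open>R\<close>\<close>

lemma inv_nz [simp]:
  assumes "x \<in> carrier K" "x \<noteq> \<zero>"
  shows "inv x \<in> carrier K" "x \<otimes> inv x = \<one>" "inv x \<otimes> x = \<one>" "inv x \<noteq> \<zero>"
proof -
  have u: "x \<in> Units K" using assms field_Units by auto
  show 1: "inv x \<in> carrier K" "x \<otimes> inv x = \<one>" "inv x \<otimes> x = \<one>" using u by auto
  show "inv x \<noteq> \<zero>" using 1 assms by auto
qed

lemma inv_cancel [simp]:
  assumes x: "x \<in> carrier K" "x \<noteq> \<zero>" and "z \<in> carrier K"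
  shows "x \<otimes> (inv x \<otimes> z) = z" "inv x \<otimes> (x \<otimes> z) = z"
  using assms inv_nz[OF x] m_assoc[of x "inv x" z] m_assoc[of "inv x" x z] by simp_all

lemma R_carr [simp, intro]: "r \<in> R \<Longrightarrow> r \<in> carrier K"
  using subringE(1)[OF subring_R] by auto

lemma R_zero [simp, intro]: "\<zero> \<in> R" and R_one [simp, intro]: "\<one> \<in> R"
  and R_mult [simp, intro]: "a \<in> R \<Longrightarrow> b \<in> R \<Longrightarrow> a \<otimes> b \<in> R"
  and R_add [simp, intro]: "a \<in> R \<Longrightarrow> b \<in> R \<Longrightarrow> a \<oplus> b \<in> R"
  and R_neg [simp, intro]: "a \<in> R \<Longrightarrow> \<ominus> a \<in> R"
  using subringE[OF subring_R] by auto

lemma denominator: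
  assumes "x \<in> carrier K"
  obtains b where "b \<in> R" "b \<noteq> \<zero>" "b \<otimes> x \<in> R"
proof -
  obtain a b where ab: "x = a \<otimes> inv b" "a \<in> R" "b \<in> R" "b \<noteq> \<zero>" using assms carrier_quot by auto
  then have "b \<otimes> x = a" by (simp add: m_lcomm)
  then show ?thesis using ab that by auto
qed

section \<open>Submodules of \<open>K\<close> and fractional ideals\<close>

lemma submoduleI:
  assumes "I \<subseteq> carrier K" "\<zero> \<in> I" "\<And>a b. a \<in> I \<Longrightarrow> b \<in> I \<Longrightarrow> a \<oplus> b \<in> I"
    and sm: "\<And>r a. r \<in> R \<Longrightarrow> a \<in> I \<Longrightarrow> r \<otimes> a \<in> I"
  shows "subalgebra R I K"
proof (intro subalgebra.intro add.subgroupI subalgebra_axioms.intro)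
  fix a assume a: "a \<in> I"
  have "\<ominus> a = (\<ominus> \<one>) \<otimes> a" using a assms(1) l_minus by auto
  then have "\<ominus> a \<in> I" using a sm[of "\<ominus> \<one>" a] by auto
  then show "\<ominus> a \<in> I" .
qed (use assms in auto)

lemma submoduleD:
  assumes "subalgebra R I K"
  shows "I \<subseteq> carrier K" "\<zero> \<in> I" "\<And>a b. a \<in> I \<Longrightarrow> b \<in> I \<Longrightarrow> a \<oplus> b \<in> I"
    "\<And>r a. r \<in> R \<Longrightarrow> a \<in> I \<Longrightarrow> r \<otimes> a \<in> I"
proof -
  interpret subalgebra R I K by fact
  show "I \<subseteq> carrier K" "\<zero> \<in> I" "\<And>a b. a \<in> I \<Longrightarrow> b \<in> I \<Longrightarrow> a \<oplus> b \<in> I"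
    "\<And>r a. r \<in> R \<Longrightarrow> a \<in> I \<Longrightarrow> r \<otimes> a \<in> I"
    using subset m_closed one_closed smult_closed by auto
qed

lemma fractionalI:
  assumes "subalgebra R I K" "d \<in> R" "d \<noteq> \<zero>" "\<And>i. i \<in> I \<Longrightarrow> d \<otimes> i \<in> R"
  shows "I \<in> fractional_ideals K R"
  using assms unfolding fractional_ideals_def l_coset_def by auto

lemma fractionalD:
  assumes "I \<in> fractional_ideals K R"
  shows "subalgebra R I K" "\<exists>d\<in>R. d \<noteq> \<zero> \<and> (\<forall>i\<in>I. d \<otimes> i \<in> R)"
    "I \<subseteq> carrier K" "\<zero> \<in> I"
    "\<And>a b. a \<in> I \<Longrightarrow> b \<in> I \<Longrightarrow> a \<oplus> b \<in> I"
    "\<And>r a. r \<in> R \<Longrightarrow> a \<in> I \<Longrightarrow> r \<otimes> a \<in> I"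
proof -
  have *: "subalgebra R I K \<and> (\<exists>d\<in>R - {\<zero>}. (\<Union>h\<in>I. {d \<otimes> h}) \<subseteq> R)"
    using assms unfolding fractional_ideals_def l_coset_def by simp
  then show "\<exists>d\<in>R. d \<noteq> \<zero> \<and> (\<forall>i\<in>I. d \<otimes> i \<in> R)" by blast
  show I: "subalgebra R I K" using * by blast
  show "I \<subseteq> carrier K" "\<zero> \<in> I"
    "\<And>a b. a \<in> I \<Longrightarrow> b \<in> I \<Longrightarrow> a \<oplus> b \<in> I"
    "\<And>r a. r \<in> R \<Longrightarrow> a \<in> I \<Longrightarrow> r \<otimes> a \<in> I"
    using submoduleD[OF I] by blast+
qed

section \<open>Colons, products and multiples of fractional ideals\<close>

lemma mem_colon: "x \<in> colon K I J \<longleftrightarrow> x \<in> carrier K \<and> (\<forall>j\<in>J. x \<otimes> j \<in> I)"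
  unfolding colon_def l_coset_def by auto

lemma mem_l_coset: "y \<in> x <#\<^bsub>K\<^esub> I \<longleftrightarrow> (\<exists>i\<in>I. y = x \<otimes> i)"
  unfolding l_coset_def by auto

text \<open>Elements of a product are finite sums, so an additively closed condition is checked on
  \<open>i \<otimes> j\<close>. Keeping the factor \<open>x\<close> outside suits tests of
  membership in a colon.\<close>

lemma prod_mult_mem:
  assumes "p \<in> I \<cdot>\<^bsub>K\<^esub> J" "I \<subseteq> carrier K" "J \<subseteq> carrier K" "x \<in> carrier K"
    and T: "\<And>a b. a \<in> T \<Longrightarrow> b \<in> T \<Longrightarrow> a \<oplus> b \<in> T"
    and ij: "\<And>i j. i \<in> I \<Longrightarrow> j \<in> J \<Longrightarrow> x \<otimes> (i \<otimes> j) \<in> T"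
  shows "x \<otimes> p \<in> T"
proof -
  \<comment> \<open>Membership of \<open>p\<close> in \<open>K\<close> is carried along because the
    sum case uses distributivity.\<close>
  have "p \<in> carrier K \<and> x \<otimes> p \<in> T" using assms(1)
  proof (induct p rule: ideal_prod.induct)
    case (prod i j) then show ?case using assms by auto
  next
    case (sum s1 s2) then show ?case using T r_distr assms(4) by auto
  qed
  then show ?thesis by blast
qed

lemma prod_mem:
  assumes "p \<in> I \<cdot>\<^bsub>K\<^esub> J"
    and T: "\<And>a b. a \<in> T \<Longrightarrow> b \<in> T \<Longrightarrow> a \<oplus> b \<in> T"
    and ij: "\<And>i j. i \<in> I \<Longrightarrow> j \<in> J \<Longrightarrow> i \<otimes> j \<in> T"
  shows "p \<in> T"
  using assms(1) by (induct p rule: ideal_prod.induct) (auto intro: T ij)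

lemma submodule_R: "subalgebra R R K"
  by (rule submoduleI) auto

lemma fractional_R: "R \<in> fractional_ideals K R"
  by (rule fractionalI[OF submodule_R R_one]) auto

lemma submodule_colon:
  assumes "subalgebra R T K" "J \<subseteq> carrier K"
  shows "subalgebra R (colon K T J) K"
proof (rule submoduleI)
  note T = submoduleD[OF assms(1)]
  show "\<zero> \<in> colon K T J" using assms T by (auto simp: mem_colon intro: T)
  fix a b assume "a \<in> colon K T J" "b \<in> colon K T J"
  then show "a \<oplus> b \<in> colon K T J" using assms(2) T by (auto simp: mem_colon l_distr subsetD)
next
  note T = submoduleD[OF assms(1)]
  fix r a assume "r \<in> R" "a \<in> colon K T J"
  then show "r \<otimes> a \<in> colon K T J" using assms(2) T by (auto simp: mem_colon m_assoc subsetD)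
qed (auto simp: mem_colon)

lemma submodule_prod:
  assumes "subalgebra R I K" "J \<subseteq> carrier K" "J \<noteq> {}"
  shows "subalgebra R (I \<cdot>\<^bsub>K\<^esub> J) K"
proof (rule submoduleI)
  note I = submoduleD[OF assms(1)]
  show sub: "I \<cdot>\<^bsub>K\<^esub> J \<subseteq> carrier K"
    by (rule subsetI, erule prod_mem) (use I assms in auto)
  obtain j where j: "j \<in> J" using assms by auto
  have "\<zero> \<otimes> j \<in> I \<cdot>\<^bsub>K\<^esub> J" by (rule ideal_prod.prod) (use I j in auto)
  then show "\<zero> \<in> I \<cdot>\<^bsub>K\<^esub> J" using j assms by auto
  fix r a assume r: "r \<in> R" and a: "a \<in> I \<cdot>\<^bsub>K\<^esub> J"
  show "r \<otimes> a \<in> I \<cdot>\<^bsub>K\<^esub> J"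
  proof (rule prod_mult_mem[OF a])
    fix i j assume ij: "i \<in> I" "j \<in> J"
    have "r \<otimes> (i \<otimes> j) = (r \<otimes> i) \<otimes> j" using ij r I assms by (auto simp: m_assoc subsetD)
    then show "r \<otimes> (i \<otimes> j) \<in> I \<cdot>\<^bsub>K\<^esub> J" using I(4)[OF r ij(1)] ij(2) by (auto intro: ideal_prod.prod)
  qed (use assms I r in \<open>auto intro: ideal_prod.sum\<close>)
qed (auto intro: ideal_prod.sum)

lemma fractional_prod:
  assumes I: "I \<in> fractional_ideals K R" and J: "J \<in> fractional_ideals K R"
  shows "I \<cdot>\<^bsub>K\<^esub> J \<in> fractional_ideals K R"
proof -
  obtain d e where d: "d \<in> R" "d \<noteq> \<zero>" "\<forall>i\<in>I. d \<otimes> i \<in> R" and e: "e \<in> R" "e \<noteq> \<zero>" "\<forall>i\<in>J. e \<otimes> i \<in> R"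
    using fractionalD(2)[OF I] fractionalD(2)[OF J] by blast
  note Is = fractionalD(3)[OF I] and Js = fractionalD(3)[OF J]
  show ?thesis
  proof (rule fractionalI)
    show "subalgebra R (I \<cdot>\<^bsub>K\<^esub> J) K"
      using fractionalD[OF I] fractionalD[OF J] by (intro submodule_prod) auto
    show "d \<otimes> e \<in> R" "d \<otimes> e \<noteq> \<zero>" using d e by (auto simp: integral_iff)
    fix p assume p: "p \<in> I \<cdot>\<^bsub>K\<^esub> J"
    show "d \<otimes> e \<otimes> p \<in> R"
    proof (rule prod_mult_mem[OF p Is Js])
      fix i j assume ij: "i \<in> I" "j \<in> J"
      have "d \<otimes> e \<otimes> (i \<otimes> j) = (d \<otimes> i) \<otimes> (e \<otimes> j)" using ij d e Is Js by (auto simp: m_ac subsetD)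
      then show "d \<otimes> e \<otimes> (i \<otimes> j) \<in> R" using d e ij by auto
    qed (use d e in auto)
  qed
qed

text \<open>If \<open>b\<close> clears the denominator of \<open>i\<close>, then
  \<open>b \<otimes> i\<close> is a common denominator of \<open>(R : I)\<close>, because
  \<open>(R : I)\<close> already carries \<open>i\<close> into \<open>R\<close>.\<close>

lemma fractional_colon:
  assumes "I \<in> fractional_ideals K R" "i \<in> I" "i \<noteq> \<zero>"
  shows "colon K R I \<in> fractional_ideals K R"
proof -
  have ic: "i \<in> carrier K" using assms fractionalD(3) by blast
  obtain b where b: "b \<in> R" "b \<noteq> \<zero>" "b \<otimes> i \<in> R" by (rule denominator[OF ic])
  show ?thesis
  proof (rule fractionalI)
    show "subalgebra R (colon K R I) K" by (rule submodule_colon[OF submodule_R]) (use assms fractionalD(3) in blast)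
    show "b \<otimes> i \<in> R" "b \<otimes> i \<noteq> \<zero>" using b ic assms(3) by (auto simp: integral_iff)
    fix x assume x: "x \<in> colon K R I"
    have "b \<otimes> i \<otimes> x = b \<otimes> (x \<otimes> i)" using x b ic by (auto simp: mem_colon m_ac)
    then show "b \<otimes> i \<otimes> x \<in> R" using x b assms by (auto simp: mem_colon)
  qed
qed

lemma submodule_coset:
  assumes I: "subalgebra R I K" and x: "x \<in> carrier K"
  shows "subalgebra R (x <#\<^bsub>K\<^esub> I) K"
proof (rule submoduleI)
  note I' = submoduleD[OF I]
  show "x <#\<^bsub>K\<^esub> I \<subseteq> carrier K" using subsetD[OF I'(1)] x by (auto simp: mem_l_coset)
  show "\<zero> \<in> x <#\<^bsub>K\<^esub> I" using I' x by (auto simp: mem_l_coset intro!: bexI[of _ \<zero>])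
  show "a \<oplus> b \<in> x <#\<^bsub>K\<^esub> I" if ab: "a \<in> x <#\<^bsub>K\<^esub> I" "b \<in> x <#\<^bsub>K\<^esub> I" for a b
  proof -
    obtain i j where ij: "i \<in> I" "j \<in> I" "a = x \<otimes> i" "b = x \<otimes> j" using ab by (auto simp: mem_l_coset)
    then have "a \<oplus> b = x \<otimes> (i \<oplus> j)" using I' x by (auto simp: r_distr subsetD)
    then show ?thesis using ij I' by (auto simp: mem_l_coset)
  qed
  show "r \<otimes> a \<in> x <#\<^bsub>K\<^esub> I" if ra: "r \<in> R" "a \<in> x <#\<^bsub>K\<^esub> I" for r a
  proof -
    obtain i where i: "i \<in> I" "a = x \<otimes> i" using ra by (auto simp: mem_l_coset)
    then have "r \<otimes> a = x \<otimes> (r \<otimes> i)" using I' x ra by (auto simp: m_lcomm subsetD)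
    then show ?thesis using i I'(4)[OF ra(1) i(1)] by (auto simp: mem_l_coset)
  qed
qed

lemma fractional_coset:
  assumes I: "I \<in> fractional_ideals K R" and x: "x \<in> carrier K"
  shows "x <#\<^bsub>K\<^esub> I \<in> fractional_ideals K R"
proof -
  obtain d where d: "d \<in> R" "d \<noteq> \<zero>" "\<forall>i\<in>I. d \<otimes> i \<in> R" using fractionalD(2)[OF I] by blast
  obtain b where b: "b \<in> R" "b \<noteq> \<zero>" "b \<otimes> x \<in> R" by (rule denominator[OF x])
  note Is = fractionalD(3)[OF I]
  show ?thesis
  proof (rule fractionalI)
    show "subalgebra R (x <#\<^bsub>K\<^esub> I) K" by (rule submodule_coset[OF fractionalD(1)[OF I] x])
    show "b \<otimes> d \<in> R" "b \<otimes> d \<noteq> \<zero>" using b d by (auto simp: integral_iff)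
    fix y assume "y \<in> x <#\<^bsub>K\<^esub> I"
    then obtain i where i: "i \<in> I" "y = x \<otimes> i" by (auto simp: mem_l_coset)
    have "b \<otimes> d \<otimes> y = (b \<otimes> x) \<otimes> (d \<otimes> i)" using i b d x Is by (auto simp: m_ac subsetD)
    then show "b \<otimes> d \<otimes> y \<in> R" using i b d by auto
  qed
qed

lemma prod_commute:
  assumes "I \<subseteq> carrier K" "J \<subseteq> carrier K"
  shows "I \<cdot>\<^bsub>K\<^esub> J = J \<cdot>\<^bsub>K\<^esub> I"
proof -
  have *: "I \<cdot>\<^bsub>K\<^esub> J \<subseteq> J \<cdot>\<^bsub>K\<^esub> I" if "I \<subseteq> carrier K" "J \<subseteq> carrier K" for I J
  proof (rule subsetI, erule prod_mem)
    fix i j assume ij: "i \<in> I" "j \<in> J"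
    then have "i \<otimes> j = j \<otimes> i" using that m_comm by blast
    then show "i \<otimes> j \<in> J \<cdot>\<^bsub>K\<^esub> I" using ideal_prod.prod[OF ij(2,1)] by metis
  qed (rule ideal_prod.sum)
  show ?thesis using *[OF assms] *[OF assms(2,1)] by blast
qed

lemma prod_assoc_sub:
  assumes "I \<subseteq> carrier K" "J \<subseteq> carrier K" "L \<subseteq> carrier K"
  shows "(I \<cdot>\<^bsub>K\<^esub> J) \<cdot>\<^bsub>K\<^esub> L \<subseteq> I \<cdot>\<^bsub>K\<^esub> (J \<cdot>\<^bsub>K\<^esub> L)"
proof (rule subsetI, erule prod_mem)
  have IJ: "I \<cdot>\<^bsub>K\<^esub> J \<subseteq> carrier K" by (rule subsetI, erule prod_mem) (use assms in auto)
  fix p l assume p: "p \<in> I \<cdot>\<^bsub>K\<^esub> J" and l: "l \<in> L"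
  have "l \<otimes> p \<in> I \<cdot>\<^bsub>K\<^esub> (J \<cdot>\<^bsub>K\<^esub> L)"
  proof (rule prod_mult_mem[OF p assms(1,2)])
    fix i j assume ij: "i \<in> I" "j \<in> J"
    have "l \<otimes> (i \<otimes> j) = i \<otimes> (j \<otimes> l)" using ij l assms m_ac by (auto simp: m_ac subsetD)
    then show "l \<otimes> (i \<otimes> j) \<in> I \<cdot>\<^bsub>K\<^esub> (J \<cdot>\<^bsub>K\<^esub> L)" using ij l by (auto intro: ideal_prod.prod)
  qed (use l assms in \<open>auto intro: ideal_prod.sum\<close>)
  then show "p \<otimes> l \<in> I \<cdot>\<^bsub>K\<^esub> (J \<cdot>\<^bsub>K\<^esub> L)" using p l IJ assms(3) m_comm[of p l] by (auto dest!: subsetD)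
qed (rule ideal_prod.sum)

text \<open>One inclusion suffices: with the factors in reverse order it becomes, by commutativity,
  the other one.\<close>

lemma prod_assoc:
  assumes "I \<subseteq> carrier K" "J \<subseteq> carrier K" "L \<subseteq> carrier K"
  shows "(I \<cdot>\<^bsub>K\<^esub> J) \<cdot>\<^bsub>K\<^esub> L = I \<cdot>\<^bsub>K\<^esub> (J \<cdot>\<^bsub>K\<^esub> L)"
proof -
  have c: "A \<cdot>\<^bsub>K\<^esub> B \<subseteq> carrier K" if "A \<subseteq> carrier K" "B \<subseteq> carrier K" for A B
    by (rule subsetI, erule prod_mem) (use that in auto)
  have "I \<cdot>\<^bsub>K\<^esub> (J \<cdot>\<^bsub>K\<^esub> L) = (L \<cdot>\<^bsub>K\<^esub> J) \<cdot>\<^bsub>K\<^esub> I"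
    using assms c prod_commute by metis
  also have "\<dots> \<subseteq> L \<cdot>\<^bsub>K\<^esub> (J \<cdot>\<^bsub>K\<^esub> I)" by (rule prod_assoc_sub[OF assms(3,2,1)])
  also have "\<dots> = (I \<cdot>\<^bsub>K\<^esub> J) \<cdot>\<^bsub>K\<^esub> L" using assms c prod_commute by metis
  finally show ?thesis using prod_assoc_sub[OF assms] by blast
qed

lemma prod_coset_R:
  assumes I: "subalgebra R I K" and x: "x \<in> carrier K"
  shows "(x <#\<^bsub>K\<^esub> R) \<cdot>\<^bsub>K\<^esub> I = x <#\<^bsub>K\<^esub> I"
proof
  note I' = submoduleD[OF I] and xI = submoduleD[OF submodule_coset[OF I x]]
  show "(x <#\<^bsub>K\<^esub> R) \<cdot>\<^bsub>K\<^esub> I \<subseteq> x <#\<^bsub>K\<^esub> I"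
  proof (rule subsetI, erule prod_mem)
    fix a i assume a: "a \<in> x <#\<^bsub>K\<^esub> R" and i: "i \<in> I"
    then obtain r where r: "r \<in> R" "a = x \<otimes> r" by (auto simp: mem_l_coset)
    then have "a \<otimes> i = x \<otimes> (r \<otimes> i)" using x i I' by (auto simp: m_assoc subsetD)
    then show "a \<otimes> i \<in> x <#\<^bsub>K\<^esub> I" using I'(4)[OF r(1) i] by (auto simp: mem_l_coset)
  qed (rule xI)
  show "x <#\<^bsub>K\<^esub> I \<subseteq> (x <#\<^bsub>K\<^esub> R) \<cdot>\<^bsub>K\<^esub> I"
  proof
    fix a assume "a \<in> x <#\<^bsub>K\<^esub> I"
    then obtain i where i: "i \<in> I" "a = x \<otimes> i" by (auto simp: mem_l_coset)
    have "x \<in> x <#\<^bsub>K\<^esub> R" using x by (auto simp: mem_l_coset intro!: bexI[of _ \<one>])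
    then show "a \<in> (x <#\<^bsub>K\<^esub> R) \<cdot>\<^bsub>K\<^esub> I" using i by (auto intro: ideal_prod.prod)
  qed
qed

lemma one_coset:
  assumes "I \<subseteq> carrier K"
  shows "\<one> <#\<^bsub>K\<^esub> I = I"
proof -
  have "\<one> \<otimes> i = i" if "i \<in> I" for i using assms that by auto
  then show ?thesis unfolding l_coset_def by auto
qed

lemma prod_R: "subalgebra R I K \<Longrightarrow> R \<cdot>\<^bsub>K\<^esub> I = I"
  using prod_coset_R[of I \<one>] one_coset submoduleD(1) submoduleD(1)[OF submodule_R] by auto

lemma coset_coset:
  assumes "I \<subseteq> carrier K" "x \<in> carrier K" "y \<in> carrier K"
  shows "x <#\<^bsub>K\<^esub> (y <#\<^bsub>K\<^esub> I) = (x \<otimes> y) <#\<^bsub>K\<^esub> I"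
proof -
  have "x \<otimes> (y \<otimes> i) = x \<otimes> y \<otimes> i" if "i \<in> I" for i using assms that by (auto simp: m_assoc subsetD)
  then show ?thesis unfolding l_coset_def by auto
qed

end

section \<open>Star operations and products\<close>

locale star_domain = qdomain K R for K :: "('a, 'm) ring_scheme" (structure) and R +
  fixes star :: "'a set \<Rightarrow> 'a set"
  assumes star_op: "star_operation K R star"
begin

lemma star_frac [intro]: "I \<in> fractional_ideals K R \<Longrightarrow> star I \<in> fractional_ideals K R"
  and star_incl: "I \<in> fractional_ideals K R \<Longrightarrow> I \<subseteq> star I"
  and star_idem: "I \<in> fractional_ideals K R \<Longrightarrow> star (star I) = star I"
  and star_mono: "I \<in> fractional_ideals K R \<Longrightarrow> J \<in> fractional_ideals K R \<Longrightarrow> I \<subseteq> J \<Longrightarrow> star I \<subseteq> star J"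
  and star_R: "star R = R"
  and star_coset: "I \<in> fractional_ideals K R \<Longrightarrow> x \<in> carrier K \<Longrightarrow> star (x <#\<^bsub>K\<^esub> I) = x <#\<^bsub>K\<^esub> star I"
  using star_op unfolding star_operation_def by auto

text \<open>The working form of the star axioms:
  \<open>x (star I) = star (x I) \<subseteq> star T = T\<close>.\<close>

lemma star_mult:
  assumes I: "I \<in> fractional_ideals K R" and T: "T \<in> fractional_ideals K R" "star T = T"
    and x: "x \<in> carrier K" and xI: "\<And>i. i \<in> I \<Longrightarrow> x \<otimes> i \<in> T" and i: "i \<in> star I"
  shows "x \<otimes> i \<in> T"
proof -
  have "x <#\<^bsub>K\<^esub> I \<subseteq> T" using xI by (auto simp: mem_l_coset)
  then have "x <#\<^bsub>K\<^esub> star I \<subseteq> T" using star_mono[OF fractional_coset[OF I x] T(1)] star_coset[OF I x] T(2) by auto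
  moreover have "x \<otimes> i \<in> x <#\<^bsub>K\<^esub> star I" using i by (auto simp: mem_l_coset)
  ultimately show ?thesis by blast
qed

lemma star_subset:
  assumes I: "I \<in> fractional_ideals K R" and T: "T \<in> fractional_ideals K R" "star T = T" and "I \<subseteq> T"
  shows "star I \<subseteq> T"
  using star_mono[OF I T(1) assms(4)] T by simp

text \<open>For fixed \<open>j\<close>, multiplication by \<open>j\<close> sends \<open>I\<close>
  into the star-closed \<open>star (I J)\<close>, hence also \<open>star I\<close>.\<close>

lemma star_prod_star_left:
  assumes I: "I \<in> fractional_ideals K R" and J: "J \<in> fractional_ideals K R"
  shows "star (star I \<cdot>\<^bsub>K\<^esub> J) = star (I \<cdot>\<^bsub>K\<^esub> J)"
proof
  note IJ = fractional_prod[OF I J] and sIJ = fractional_prod[OF star_frac[OF I] J]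
  note c = fractionalD(3)[OF J] fractionalD(3)[OF I] fractionalD(3)[OF star_frac[OF I]]
  show "star (I \<cdot>\<^bsub>K\<^esub> J) \<subseteq> star (star I \<cdot>\<^bsub>K\<^esub> J)"
  proof (rule star_mono[OF IJ sIJ], rule subsetI, erule prod_mem)
    fix i j assume "i \<in> I" "j \<in> J"
    then show "i \<otimes> j \<in> star I \<cdot>\<^bsub>K\<^esub> J" using star_incl[OF I] by (auto intro: ideal_prod.prod)
  qed (rule ideal_prod.sum)
  show "star (star I \<cdot>\<^bsub>K\<^esub> J) \<subseteq> star (I \<cdot>\<^bsub>K\<^esub> J)"
  proof (rule star_subset[OF sIJ star_frac[OF IJ] star_idem[OF IJ]], rule subsetI, erule prod_mem)
    fix i j assume i: "i \<in> star I" and j: "j \<in> J"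
    have "j \<otimes> i \<in> star (I \<cdot>\<^bsub>K\<^esub> J)"
    proof (rule star_mult[OF I star_frac[OF IJ] star_idem[OF IJ] _ _ i])
      show "j \<in> carrier K" using j c by auto
      fix i assume i: "i \<in> I"
      have "i \<otimes> j \<in> star (I \<cdot>\<^bsub>K\<^esub> J)" using star_incl[OF IJ] ideal_prod.prod[OF i j] by auto
      moreover have "i \<otimes> j = j \<otimes> i" using i j c by (intro m_comm) blast+
      ultimately show "j \<otimes> i \<in> star (I \<cdot>\<^bsub>K\<^esub> J)" by simp
    qed
    moreover have "i \<otimes> j = j \<otimes> i" using i j c by (intro m_comm) blast+
    ultimately show "i \<otimes> j \<in> star (I \<cdot>\<^bsub>K\<^esub> J)" by simp
  qed (rule fractionalD(5)[OF star_frac[OF IJ]])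
qed

lemma star_prod_star_right:
  assumes I: "I \<in> fractional_ideals K R" and J: "J \<in> fractional_ideals K R"
  shows "star (I \<cdot>\<^bsub>K\<^esub> star J) = star (I \<cdot>\<^bsub>K\<^esub> J)"
  using star_prod_star_left[OF J I] prod_commute fractionalD(3)[OF I] fractionalD(3)[OF J] fractionalD(3)[OF star_frac[OF J]]
  by metis

section \<open>The group of star-invertible star-closed ideals\<close>

abbreviation "G \<equiv> Inv_star K R star"

lemma mem_Inv: "I \<in> carrier G \<longleftrightarrow> I \<in> fractional_ideals K R \<and> star (I \<cdot>\<^bsub>K\<^esub> colon K R I) = R \<and> star I = I"
  unfolding Inv_star_def star_invertible_def by auto

lemma mult_Inv: "I \<otimes>\<^bsub>G\<^esub> J = star (I \<cdot>\<^bsub>K\<^esub> J)" and one_Inv: "\<one>\<^bsub>G\<^esub> = R"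
  unfolding Inv_star_def by auto

text \<open>The zero ideal is excluded by homogeneity at \<open>\<zero>\<close>: its product with
  its colon \<open>K\<close> is \<open>{\<zero>}\<close>, that is \<open>\<zero>\<close> times
  \<open>R\<close>, whose closure is again \<open>{\<zero>}\<close>.\<close>

lemma Inv_nonzero:
  assumes "I \<in> fractional_ideals K R" "star (I \<cdot>\<^bsub>K\<^esub> colon K R I) = R"
  obtains i where "i \<in> I" "i \<noteq> \<zero>"
proof -
  have "\<exists>i\<in>I. i \<noteq> \<zero>"
  proof (rule ccontr)
    assume "\<not> (\<exists>i\<in>I. i \<noteq> \<zero>)"
    then have I0: "I = {\<zero>}" using fractionalD(4)[OF assms(1)] by blast
    have c: "colon K R {\<zero>} = carrier K" by (auto simp: mem_colon)
    have "I \<cdot>\<^bsub>K\<^esub> colon K R I \<subseteq> {\<zero>}" unfolding I0 c by (rule subsetI, erule prod_mem) auto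
    moreover have "\<zero> \<otimes> \<zero> \<in> I \<cdot>\<^bsub>K\<^esub> colon K R I" unfolding I0 c by (rule ideal_prod.prod) auto
    ultimately have "I \<cdot>\<^bsub>K\<^esub> colon K R I = {\<zero>}" by auto
    also have "\<dots> = \<zero> <#\<^bsub>K\<^esub> R" by (auto simp: mem_l_coset intro!: exI[of _ \<one>])
    finally have "star (I \<cdot>\<^bsub>K\<^esub> colon K R I) = \<zero> <#\<^bsub>K\<^esub> R" using star_coset[OF fractional_R, of \<zero>] star_R by auto
    then have "\<one> \<in> \<zero> <#\<^bsub>K\<^esub> R" using assms(2) by auto
    then show False by (auto simp: mem_l_coset)
  qed
  then show ?thesis using that by blast
qed

lemma colon_frac:
  assumes "I \<in> fractional_ideals K R" "star (I \<cdot>\<^bsub>K\<^esub> colon K R I) = R"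
  shows "colon K R I \<in> fractional_ideals K R"
  using Inv_nonzero[OF assms] fractional_colon[OF assms(1)] by metis

lemma prod_colon_subset: "I \<subseteq> carrier K \<Longrightarrow> I \<cdot>\<^bsub>K\<^esub> colon K R I \<subseteq> R"
proof (rule subsetI, erule prod_mem)
  fix i j assume "I \<subseteq> carrier K" "i \<in> I" "j \<in> colon K R I"
  then show "i \<otimes> j \<in> R" using m_comm[of i j] by (auto simp: mem_colon)
qed (auto)

text \<open>\<open>(R : I)\<close> is cut out by the conditions \<open>i \<otimes> e \<in> R\<close>
  for \<open>i \<in> I\<close>, and each of them passes to the closure because \<open>R\<close> is
  star-closed.\<close>

lemma star_colon:
  assumes "I \<in> fractional_ideals K R" "star (I \<cdot>\<^bsub>K\<^esub> colon K R I) = R"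
  shows "star (colon K R I) = colon K R I"
proof
  note D = colon_frac[OF assms] and Ic = fractionalD(3)[OF assms(1)]
  show "colon K R I \<subseteq> star (colon K R I)" by (rule star_incl[OF D])
  show "star (colon K R I) \<subseteq> colon K R I"
  proof
    fix d assume d: "d \<in> star (colon K R I)"
    have dc: "d \<in> carrier K" using d fractionalD(3)[OF star_frac[OF D]] by auto
    have "i \<otimes> d \<in> R" if i: "i \<in> I" for i
    proof (rule star_mult[OF D fractional_R star_R _ _ d])
      show "i \<in> carrier K" using i Ic by auto
      fix e assume "e \<in> colon K R I"
      then show "i \<otimes> e \<in> R" using i Ic m_comm[of i e] by (auto simp: mem_colon)
    qed
    then have "d \<otimes> i \<in> R" if "i \<in> I" for i using \<open>\<And>i. i \<in> I \<Longrightarrow> i \<otimes> d \<in> R\<close>[OF that] m_comm[of i d] dc subsetD[OF Ic that] by simp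
    then show "d \<in> colon K R I" using dc by (auto simp: mem_colon)
  qed
qed

text \<open>A criterion that avoids computing \<open>(R : I)\<close>. The set \<open>D\<close> is
  part of the colon, and the closure of \<open>I (R : I)\<close> is one of the star-closed
  \<open>T\<close> that contain all products of \<open>I\<close> and \<open>D\<close>.\<close>

lemma mem_InvI:
  assumes I: "I \<in> fractional_ideals K R" "star I = I" and D: "D \<subseteq> carrier K"
    and ID: "\<And>i d. i \<in> I \<Longrightarrow> d \<in> D \<Longrightarrow> i \<otimes> d \<in> R"
    and fr: "I \<cdot>\<^bsub>K\<^esub> colon K R I \<in> fractional_ideals K R"
    and gen: "\<And>T. T \<in> fractional_ideals K R \<Longrightarrow> star T = T \<Longrightarrow> (\<And>i d. i \<in> I \<Longrightarrow> d \<in> D \<Longrightarrow> i \<otimes> d \<in> T) \<Longrightarrow> \<one> \<in> T"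
  shows "I \<in> carrier G"
proof -
  note Ic = fractionalD(3)[OF I(1)]
  have DD: "D \<subseteq> colon K R I"
  proof
    fix d assume d: "d \<in> D"
    have "d \<otimes> i \<in> R" if "i \<in> I" for i using ID[OF that d] m_comm[of i d] subsetD[OF Ic that] subsetD[OF D d] by simp
    then show "d \<in> colon K R I" using d D by (auto simp: mem_colon)
  qed
  let ?U = "star (I \<cdot>\<^bsub>K\<^esub> colon K R I)"
  have "\<one> \<in> ?U"
  proof (rule gen[OF star_frac[OF fr] star_idem[OF fr]])
    fix i d assume "i \<in> I" "d \<in> D"
    then show "i \<otimes> d \<in> ?U" using star_incl[OF fr] DD by (auto intro!: ideal_prod.prod)
  qed
  then have "R \<subseteq> ?U" using fractionalD(6)[OF star_frac[OF fr], of _ \<one>] by auto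
  moreover have "?U \<subseteq> R" by (rule star_subset[OF fr fractional_R star_R prod_colon_subset[OF Ic]])
  ultimately show ?thesis using I by (auto simp: mem_Inv)
qed

text \<open>If \<open>x\<close> carries \<open>I (R : I)\<close> into the star-closed
  \<open>T\<close>, it also carries the closure there, and the closure contains
  \<open>\<one>\<close>. This strips off one star-invertible ideal at a time.\<close>

lemma Inv_gen:
  assumes I: "I \<in> fractional_ideals K R" "star (I \<cdot>\<^bsub>K\<^esub> colon K R I) = R"
    and T: "T \<in> fractional_ideals K R" "star T = T" and x: "x \<in> carrier K"
    and id: "\<And>i d. i \<in> I \<Longrightarrow> d \<in> colon K R I \<Longrightarrow> x \<otimes> (i \<otimes> d) \<in> T"
  shows "x \<in> T"
proof -
  note D = colon_frac[OF I]
  have "x \<otimes> \<one> \<in> T"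
  proof (rule star_mult[OF fractional_prod[OF I(1) D] T x])
    fix p assume "p \<in> I \<cdot>\<^bsub>K\<^esub> colon K R I"
    then show "x \<otimes> p \<in> T"
      by (rule prod_mult_mem[OF _ fractionalD(3)[OF I(1)] fractionalD(3)[OF D] x fractionalD(5)[OF T(1)] id])
  qed (simp add: I(2))
  then show ?thesis using x by simp
qed

text \<open>The criterion is applied with \<open>I\<close> as set of multipliers of
  \<open>(R : I)\<close>; the products are those that witness invertibility of
  \<open>I\<close>.\<close>

lemma Inv_colon:
  assumes "I \<in> carrier G"
  shows "colon K R I \<in> carrier G"
proof -
  have I: "I \<in> fractional_ideals K R" "star (I \<cdot>\<^bsub>K\<^esub> colon K R I) = R" using assms by (auto simp: mem_Inv)
  note D = colon_frac[OF I] and Ic = fractionalD(3)[OF I(1)]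
  obtain i where i: "i \<in> I" "i \<noteq> \<zero>" by (rule Inv_nonzero[OF I])
  \<comment> \<open>A common denominator of \<open>I\<close> is a nonzero element of the colon,
    which makes the double colon fractional.\<close>
  obtain d where "d \<in> colon K R I" "d \<noteq> \<zero>" using fractionalD(2)[OF I(1)] by (auto simp: mem_colon)
  then have DDf: "colon K R (colon K R I) \<in> fractional_ideals K R" by (rule fractional_colon[OF D])
  show ?thesis
  proof (rule mem_InvI[OF D star_colon[OF I] Ic _ fractional_prod[OF D DDf]])
    show "d \<otimes> i \<in> R" if "i \<in> I" "d \<in> colon K R I" for i d using that by (auto simp: mem_colon)
    fix T assume T: "T \<in> fractional_ideals K R" "star T = T" and di: "\<And>d i. d \<in> colon K R I \<Longrightarrow> i \<in> I \<Longrightarrow> d \<otimes> i \<in> T"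
    show "\<one> \<in> T"
    proof (rule Inv_gen[OF I T])
      fix i d assume id: "i \<in> I" "d \<in> colon K R I"
      then have "i \<otimes> d = d \<otimes> i" "i \<otimes> d \<in> carrier K" using m_comm Ic by (auto simp: mem_colon)
      then show "\<one> \<otimes> (i \<otimes> d) \<in> T" using di[OF id(2,1)] by simp
    qed auto
  qed
qed

lemma colon_star_prod:
  assumes I: "I \<in> fractional_ideals K R" and J: "J \<in> fractional_ideals K R"
    and d: "d \<in> colon K R I" "e \<in> colon K R J"
  shows "d \<otimes> e \<in> colon K R (star (I \<cdot>\<^bsub>K\<^esub> J))"
proof -
  have dc: "d \<in> carrier K" "e \<in> carrier K" using d by (auto simp: mem_colon)
  note c = fractionalD(3)[OF I] fractionalD(3)[OF J]
  have "d \<otimes> e \<otimes> x \<in> R" if x: "x \<in> star (I \<cdot>\<^bsub>K\<^esub> J)" for x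
  proof (rule star_mult[OF fractional_prod[OF I J] fractional_R star_R _ _ x])
    fix p assume p: "p \<in> I \<cdot>\<^bsub>K\<^esub> J"
    show "d \<otimes> e \<otimes> p \<in> R"
    proof (rule prod_mult_mem[OF p c])
      fix i j assume ij: "i \<in> I" "j \<in> J"
      have "d \<otimes> e \<otimes> (i \<otimes> j) = (d \<otimes> i) \<otimes> (e \<otimes> j)" using ij dc c by (auto simp: m_ac subsetD)
      then show "d \<otimes> e \<otimes> (i \<otimes> j) \<in> R" using d ij by (auto simp: mem_colon)
    qed (use dc in auto)
  qed (use dc in auto)
  then show ?thesis using dc by (auto simp: mem_colon)
qed

text \<open>Products of elements of \<open>(R : I)\<close> and \<open>(R : J)\<close> serve as
  multipliers of \<open>star (I J)\<close>.\<close>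

lemma Inv_star_prod:
  assumes "I \<in> carrier G" "J \<in> carrier G"
  shows "star (I \<cdot>\<^bsub>K\<^esub> J) \<in> carrier G"
proof -
  have I: "I \<in> fractional_ideals K R" "star (I \<cdot>\<^bsub>K\<^esub> colon K R I) = R" using assms by (auto simp: mem_Inv)
  have J: "J \<in> fractional_ideals K R" "star (J \<cdot>\<^bsub>K\<^esub> colon K R J) = R" using assms by (auto simp: mem_Inv)
  note DI = colon_frac[OF I] and Ic = fractionalD(3)[OF I(1)]
  note DJ = colon_frac[OF J] and Jc = fractionalD(3)[OF J(1)]
  note IJ = fractional_prod[OF I(1) J(1)]
  note T = star_frac[OF IJ] and Tc = fractionalD(3)[OF star_frac[OF IJ]]
  obtain i j where ij: "i \<in> I" "i \<noteq> \<zero>" "j \<in> J" "j \<noteq> \<zero>" using Inv_nonzero[OF I] Inv_nonzero[OF J] by metis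
  have "i \<otimes> j \<in> star (I \<cdot>\<^bsub>K\<^esub> J)" using star_incl[OF IJ] ideal_prod.prod[OF ij(1,3)] by auto
  moreover have "i \<otimes> j \<noteq> \<zero>" using ij Ic Jc by (auto simp: integral_iff subsetD)
  ultimately have cT: "colon K R (star (I \<cdot>\<^bsub>K\<^esub> J)) \<in> fractional_ideals K R" by (rule fractional_colon[OF T])
  let ?D = "{d \<otimes> e | d e. d \<in> colon K R I \<and> e \<in> colon K R J}"
  show ?thesis
  proof (rule mem_InvI[OF T star_idem[OF IJ] _ _ fractional_prod[OF T cT], of ?D])
    show "?D \<subseteq> carrier K" by (auto simp: mem_colon)
    show "x \<otimes> d \<in> R" if "x \<in> star (I \<cdot>\<^bsub>K\<^esub> J)" "d \<in> ?D" for x d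
    proof -
      have "d \<in> colon K R (star (I \<cdot>\<^bsub>K\<^esub> J))" using that colon_star_prod[OF I(1) J(1)] by auto
      then show ?thesis using that(1) Tc m_comm[of x d] by (auto simp: mem_colon)
    qed
    fix U assume U: "U \<in> fractional_ideals K R" "star U = U" and xd: "\<And>x d. x \<in> star (I \<cdot>\<^bsub>K\<^esub> J) \<Longrightarrow> d \<in> ?D \<Longrightarrow> x \<otimes> d \<in> U"
    \<comment> \<open>Cancelling \<open>J\<close> reduces \<open>\<one>\<close> to the elements
      \<open>j \<otimes> e\<close>; each of these is then reached by cancelling
      \<open>I\<close>.\<close>
    show "\<one> \<in> U"
    proof (rule Inv_gen[OF J U])
      fix j e assume j: "j \<in> J" and e: "e \<in> colon K R J"
      have je: "j \<in> carrier K" "e \<in> carrier K" using j e Jc by (auto simp: mem_colon)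
      have "j \<otimes> e \<in> U"
      proof (rule Inv_gen[OF I U])
        fix i d assume i: "i \<in> I" and d: "d \<in> colon K R I"
        have "i \<in> carrier K" "d \<in> carrier K" using i d Ic by (auto simp: mem_colon)
        then have "j \<otimes> e \<otimes> (i \<otimes> d) = (i \<otimes> j) \<otimes> (d \<otimes> e)" using je by (simp add: m_ac)
        moreover have "i \<otimes> j \<in> star (I \<cdot>\<^bsub>K\<^esub> J)" using star_incl[OF IJ] ideal_prod.prod[OF i j] by auto
        moreover have "d \<otimes> e \<in> ?D" using d e by auto
        ultimately show "j \<otimes> e \<otimes> (i \<otimes> d) \<in> U" using xd by auto
      qed (use je in auto)
      then show "\<one> \<otimes> (j \<otimes> e) \<in> U" using je by auto
    qed auto
  qed
qed

lemma Inv_R: "R \<in> carrier G"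
proof (rule mem_InvI[OF fractional_R star_R, of "{\<one>}"])
  have "\<one> \<in> R" "\<one> \<noteq> \<zero>" by auto
  then show "R \<cdot>\<^bsub>K\<^esub> colon K R R \<in> fractional_ideals K R"
    by (intro fractional_prod fractional_R fractional_colon) 
  show "\<one> \<in> T" if "\<And>i d. i \<in> R \<Longrightarrow> d \<in> {\<one>} \<Longrightarrow> i \<otimes> d \<in> T" for T using that[of \<one> \<one>] by auto
qed auto

text \<open>Both bracketings in the associative law equal the closure of the triple product, since
  closing a factor first does not matter. The inverse of \<open>I\<close> is
  \<open>(R : I)\<close>.\<close>

lemma comm_group_Inv: "comm_group G"
proof (rule comm_groupI)
  fix I J assume I: "I \<in> carrier G" and J: "J \<in> carrier G"
  show "I \<otimes>\<^bsub>G\<^esub> J \<in> carrier G" using Inv_star_prod[OF I J] by (simp add: mult_Inv)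
  have If: "I \<in> fractional_ideals K R" and Jf: "J \<in> fractional_ideals K R" using I J by (auto simp: mem_Inv)
  show "I \<otimes>\<^bsub>G\<^esub> J = J \<otimes>\<^bsub>G\<^esub> I"
    using prod_commute fractionalD(3)[OF If] fractionalD(3)[OF Jf] by (auto simp: mult_Inv)
  fix L assume L: "L \<in> carrier G"
  have Lf: "L \<in> fractional_ideals K R" using L by (auto simp: mem_Inv)
  show "I \<otimes>\<^bsub>G\<^esub> J \<otimes>\<^bsub>G\<^esub> L = I \<otimes>\<^bsub>G\<^esub> (J \<otimes>\<^bsub>G\<^esub> L)"
    using star_prod_star_left[OF fractional_prod[OF If Jf] Lf] star_prod_star_right[OF If fractional_prod[OF Jf Lf]]
      prod_assoc[OF fractionalD(3)[OF If] fractionalD(3)[OF Jf] fractionalD(3)[OF Lf]]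
    by (simp add: mult_Inv)
next
  fix I assume I: "I \<in> carrier G"
  then have If: "I \<in> fractional_ideals K R" "star (I \<cdot>\<^bsub>K\<^esub> colon K R I) = R" by (auto simp: mem_Inv)
  show "\<one>\<^bsub>G\<^esub> \<otimes>\<^bsub>G\<^esub> I = I" using I prod_R[OF fractionalD(1)] by (auto simp: mult_Inv one_Inv mem_Inv)
  have "colon K R I \<otimes>\<^bsub>G\<^esub> I = \<one>\<^bsub>G\<^esub>"
    using If(2) prod_commute[OF fractionalD(3)[OF If(1)] fractionalD(3)[OF colon_frac[OF If]]]
    by (simp add: mult_Inv one_Inv)
  then show "\<exists>J\<in>carrier G. J \<otimes>\<^bsub>G\<^esub> I = \<one>\<^bsub>G\<^esub>" using Inv_colon[OF I] by blast
qed (auto simp: one_Inv Inv_R)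

section \<open>Principal ideals and the class group\<close>

lemma coset_R_Inv:
  assumes x: "x \<in> carrier K" "x \<noteq> \<zero>"
  shows "x <#\<^bsub>K\<^esub> R \<in> carrier G"
proof (rule mem_InvI[OF fractional_coset[OF fractional_R x(1)]])
  show "star (x <#\<^bsub>K\<^esub> R) = x <#\<^bsub>K\<^esub> R" using star_coset[OF fractional_R x(1)] star_R by simp
  show "{inv x} \<subseteq> carrier K" using x by simp
  have xx: "x \<in> x <#\<^bsub>K\<^esub> R" using x by (auto simp: mem_l_coset intro!: bexI[of _ \<one>])
  then show "(x <#\<^bsub>K\<^esub> R) \<cdot>\<^bsub>K\<^esub> colon K R (x <#\<^bsub>K\<^esub> R) \<in> fractional_ideals K R"
    using x by (intro fractional_prod fractional_coset fractional_R fractional_colon) auto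
  show "i \<otimes> d \<in> R" if id: "i \<in> x <#\<^bsub>K\<^esub> R" "d \<in> {inv x}" for i d
  proof -
    obtain r where r: "r \<in> R" "i = x \<otimes> r" using id by (auto simp: mem_l_coset)
    have "i \<otimes> d = (x \<otimes> inv x) \<otimes> r" unfolding r(2) using r x id inv_nz(1)[OF x] by (simp add: m_ac)
    then show ?thesis using r x by simp
  qed
  show "\<one> \<in> T" if "\<And>i d. i \<in> x <#\<^bsub>K\<^esub> R \<Longrightarrow> d \<in> {inv x} \<Longrightarrow> i \<otimes> d \<in> T" for T
    using that[OF xx, of "inv x"] x by simp
qed

lemma coset_mult_Inv:
  assumes "x \<in> carrier K" "I \<in> carrier G"
  shows "(x <#\<^bsub>K\<^esub> R) \<otimes>\<^bsub>G\<^esub> I = x <#\<^bsub>K\<^esub> I"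
  using assms prod_coset_R[OF fractionalD(1)] star_coset by (auto simp: mult_Inv mem_Inv)

lemma subgroup_Prin: "subgroup (Prin K R) G"
proof -
  interpret G: comm_group G by (rule comm_group_Inv)
  have Rc: "R \<subseteq> carrier K" by auto
  show ?thesis
  proof (rule G.subgroupI)
    show "Prin K R \<subseteq> carrier G" using coset_R_Inv unfolding Prin_def by auto
    show "Prin K R \<noteq> {}" unfolding Prin_def by auto
    fix I assume "I \<in> Prin K R"
    then obtain x where x: "I = x <#\<^bsub>K\<^esub> R" "x \<in> carrier K" "x \<noteq> \<zero>" by (auto simp: Prin_def)
    have "(inv x <#\<^bsub>K\<^esub> R) \<otimes>\<^bsub>G\<^esub> I = \<one>\<^bsub>G\<^esub>"
      using coset_mult_Inv[of "inv x" I] coset_R_Inv x coset_coset[OF Rc] one_coset[OF Rc] by (simp add: one_Inv)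
    then have "inv\<^bsub>G\<^esub> I = inv x <#\<^bsub>K\<^esub> R" using coset_R_Inv x by (intro G.inv_equality) auto
    then show "inv\<^bsub>G\<^esub> I \<in> Prin K R" using x inv_nz[OF x(2,3)] unfolding Prin_def by blast
    fix J assume "J \<in> Prin K R"
    then obtain y where y: "J = y <#\<^bsub>K\<^esub> R" "y \<in> carrier K" "y \<noteq> \<zero>" by (auto simp: Prin_def)
    have "I \<otimes>\<^bsub>G\<^esub> J = (x \<otimes> y) <#\<^bsub>K\<^esub> R" using coset_mult_Inv coset_R_Inv x y coset_coset[OF Rc] by simp
    moreover have "x \<otimes> y \<in> carrier K - {\<zero>}" using x y by (auto simp: integral_iff)
    ultimately show "I \<otimes>\<^bsub>G\<^esub> J \<in> Prin K R" unfolding Prin_def by blast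
  qed
qed

lemma normal_Prin: "Prin K R \<lhd> G"
proof -
  interpret comm_group G by (rule comm_group_Inv)
  show ?thesis using subgroup_imp_normal[OF subgroup_Prin] .
qed

lemma group_Cl: "group (Cl_star K R star)"
  unfolding Cl_star_def using normal.factorgroup_is_group[OF normal_Prin] .

text \<open>This description of a class no longer mentions the star operation, so classes for
  \<open>d_op\<close> and for \<open>star\<close> can be compared as sets.\<close>

lemma Prin_rcoset:
  assumes I: "I \<in> carrier G"
  shows "Prin K R #>\<^bsub>G\<^esub> I = {x <#\<^bsub>K\<^esub> I | x. x \<in> carrier K \<and> x \<noteq> \<zero>}"
  unfolding Prin_def r_coset_def using coset_mult_Inv[OF _ I] by blast

end

lemma (in qdomain) star_domain_d_op: "star_domain K R d_op"
  by unfold_locales (auto simp: star_operation_def d_op_def)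

section \<open>The v-operation, localizations and Pruefer domains\<close>

context qdomain
begin

lemma mem_v_op: "x \<in> v_op K R I \<longleftrightarrow> x \<in> carrier K \<and> (\<forall>y \<in> carrier K. (\<forall>i\<in>I. y \<otimes> i \<in> R) \<longrightarrow> x \<otimes> y \<in> R)"
  unfolding v_op_def by (auto simp: mem_colon)

lemma v_op_incl: "I \<subseteq> carrier K \<Longrightarrow> I \<subseteq> v_op K R I"
proof
  fix x assume I: "I \<subseteq> carrier K" and x: "x \<in> I"
  have "x \<otimes> y \<in> R" if "y \<in> carrier K" "\<forall>i\<in>I. y \<otimes> i \<in> R" for y
    using that x subsetD[OF I x] m_comm[of x y] by simp
  then show "x \<in> v_op K R I" using subsetD[OF I x] by (simp add: mem_v_op)
qed

lemma v_op_colonD: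
  assumes "x \<in> v_op K R I" "y \<in> carrier K" "\<And>i. i \<in> I \<Longrightarrow> y \<otimes> i \<in> R"
  shows "x \<otimes> y \<in> R" "y \<otimes> x \<in> R"
proof -
  show "x \<otimes> y \<in> R" using assms by (auto simp: mem_v_op)
  then show "y \<otimes> x \<in> R" using assms m_comm[of x y] by (auto simp: mem_v_op)
qed

lemma colon_v_op:
  assumes "I \<subseteq> carrier K"
  shows "colon K R (v_op K R I) = colon K R I"
proof
  show "colon K R (v_op K R I) \<subseteq> colon K R I" using v_op_incl[OF assms] by (auto simp only: mem_colon subset_iff)
  show "colon K R I \<subseteq> colon K R (v_op K R I)" using v_op_colonD(2)[where I = I] by (auto simp: mem_colon)
qed

text \<open>The v-closure sees a set only through its colon; later comparisons of v-closures go
  through equality of colons.\<close>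

lemma v_op_cong: "colon K R I = colon K R J \<Longrightarrow> v_op K R I = v_op K R J"
  by (simp add: v_op_def)

lemma v_op_idem: "I \<subseteq> carrier K \<Longrightarrow> v_op K R (v_op K R I) = v_op K R I"
  by (rule v_op_cong) (rule colon_v_op)

lemma colon_R: "colon K R R = R"
proof -
  have "x \<in> R" if "x \<in> carrier K" "\<forall>j\<in>R. x \<otimes> j \<in> R" for x
    using that bspec[OF that(2) R_one] by simp
  then have "colon K R R \<subseteq> R" unfolding colon_def l_coset_def by blast
  moreover have "R \<subseteq> colon K R R" by (auto simp: mem_colon)
  ultimately show ?thesis by blast
qed

lemma v_op_R: "v_op K R R = R"
  by (simp add: v_op_def colon_R)

lemma v_op_coset:
  assumes I: "I \<subseteq> carrier K" and x: "x \<in> carrier K" "x \<noteq> \<zero>"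
  shows "v_op K R (x <#\<^bsub>K\<^esub> I) = x <#\<^bsub>K\<^esub> v_op K R I"
proof
  show "v_op K R (x <#\<^bsub>K\<^esub> I) \<subseteq> x <#\<^bsub>K\<^esub> v_op K R I"
  proof
    fix z assume z: "z \<in> v_op K R (x <#\<^bsub>K\<^esub> I)"
    then have zc: "z \<in> carrier K" by (simp add: mem_v_op)
    have "inv x \<otimes> z \<in> v_op K R I" unfolding mem_v_op
    proof (intro conjI ballI impI)
      fix y assume y: "y \<in> carrier K" "\<forall>i\<in>I. y \<otimes> i \<in> R"
      have "z \<otimes> (inv x \<otimes> y) \<in> R"
      proof (rule v_op_colonD(1)[OF z])
        fix a assume "a \<in> x <#\<^bsub>K\<^esub> I"
        then obtain i where i: "i \<in> I" "a = x \<otimes> i" by (auto simp: mem_l_coset)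
        have ic: "i \<in> carrier K" using i I by auto
        have "inv x \<otimes> y \<otimes> a = x \<otimes> inv x \<otimes> (y \<otimes> i)" unfolding i(2) using x ic y inv_nz(1)[OF x] by (simp add: m_ac)
        then show "inv x \<otimes> y \<otimes> a \<in> R" using x y i ic by simp
      qed (use x y in simp)
      then show "inv x \<otimes> z \<otimes> y \<in> R" using zc y x inv_nz(1)[OF x] by (simp add: m_ac)
    qed (use x zc in simp)
    moreover have "z = x \<otimes> (inv x \<otimes> z)" using x zc by simp
    ultimately show "z \<in> x <#\<^bsub>K\<^esub> v_op K R I" by (auto simp: mem_l_coset)
  qed
  show "x <#\<^bsub>K\<^esub> v_op K R I \<subseteq> v_op K R (x <#\<^bsub>K\<^esub> I)"
  proof
    fix z assume "z \<in> x <#\<^bsub>K\<^esub> v_op K R I"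
    then obtain w where w: "w \<in> v_op K R I" "z = x \<otimes> w" by (auto simp: mem_l_coset)
    then have wc: "w \<in> carrier K" by (simp add: mem_v_op)
    show "z \<in> v_op K R (x <#\<^bsub>K\<^esub> I)" unfolding mem_v_op
    proof (intro conjI ballI impI)
      fix y assume y: "y \<in> carrier K" "\<forall>i\<in>x <#\<^bsub>K\<^esub> I. y \<otimes> i \<in> R"
      have "w \<otimes> (y \<otimes> x) \<in> R"
      proof (rule v_op_colonD(1)[OF w(1)])
        fix i assume i: "i \<in> I"
        then have "x \<otimes> i \<in> x <#\<^bsub>K\<^esub> I" by (auto simp: mem_l_coset)
        then have "y \<otimes> (x \<otimes> i) \<in> R" using y by blast
        then show "y \<otimes> x \<otimes> i \<in> R" using x y i I by (auto simp: m_assoc subsetD)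
      qed (use x y in simp)
      then show "z \<otimes> y \<in> R" unfolding w(2) using wc y x by (simp add: m_ac)
    qed (use x wc w in simp)
  qed
qed

lemma fractional_v_op:
  assumes I: "I \<in> fractional_ideals K R"
  shows "v_op K R I \<in> fractional_ideals K R"
proof -
  obtain d where d: "d \<in> R" "d \<noteq> \<zero>" "\<forall>i\<in>I. d \<otimes> i \<in> R" using fractionalD(2)[OF I] by blast
  show ?thesis
  proof (rule fractionalI[OF _ d(1,2)])
    show "subalgebra R (v_op K R I) K" unfolding v_op_def
      by (rule submodule_colon[OF submodule_R]) (auto simp: mem_colon)
    show "d \<otimes> i \<in> R" if "i \<in> v_op K R I" for i using v_op_colonD(2)[OF that] d by auto
  qed
qed

text \<open>
  For \<open>R = K\<close> the v-operation sends \<open>{0}\<close> to \<open>K\<close> and so fails to commute with multiplication by \<open>0\<close>.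
\<close>

lemma star_domain_v_op:
  assumes "R \<noteq> carrier K"
  shows "star_domain K R (v_op K R)"
proof -
  have "v_op K R (x <#\<^bsub>K\<^esub> I) = x <#\<^bsub>K\<^esub> v_op K R I" if I: "I \<in> fractional_ideals K R" and x: "x \<in> carrier K" for I x
  proof (cases "x = \<zero>")
    case True
    have *: "\<zero> <#\<^bsub>K\<^esub> J = {\<zero>}" if J: "J \<in> fractional_ideals K R" for J
    proof -
      have "\<zero> \<otimes> j = \<zero>" if "j \<in> J" for j using that fractionalD(3)[OF J] by auto
      then show ?thesis using fractionalD(4)[OF J] unfolding l_coset_def by auto
    qed
    have "y = \<zero>" if y: "y \<in> v_op K R {\<zero>}" for y
    proof (rule ccontr)
      assume y0: "y \<noteq> \<zero>"
      have yc: "y \<in> carrier K" using y by (simp add: mem_v_op)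
      have "z \<in> R" if z: "z \<in> carrier K" for z
      proof -
        have "y \<otimes> (inv y \<otimes> z) \<in> R" using v_op_colonD(1)[OF y, of "inv y \<otimes> z"] yc y0 z by auto
        then show ?thesis using yc y0 z by simp
      qed
      then show False using assms by auto
    qed
    moreover have "\<zero> \<in> v_op K R {\<zero>}" by (auto simp: mem_v_op)
    ultimately have "v_op K R {\<zero>} = {\<zero>}" by blast
    then show ?thesis using True *[OF I] *[OF fractional_v_op[OF I]] by simp
  next
    case False
    then show ?thesis using v_op_coset[OF fractionalD(3)[OF I] x] by blast
  qed
  moreover have "v_op K R I \<subseteq> v_op K R J" if "I \<subseteq> J" for I J using that by (fastforce simp: mem_v_op)
  ultimately have "star_operation K R (v_op K R)"
    unfolding star_operation_def using fractional_v_op v_op_incl v_op_idem v_op_R fractionalD(3) by auto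
  then show ?thesis by unfold_locales
qed

text \<open>Here \<open>L\<close> is just a set with a common denominator: over a localization it
  will be an \<open>R\<close>-submodule that need not be a module over the larger ring. The
  assumption \<open>gen\<close> says that the products of \<open>L\<close> and \<open>D\<close> have
  colon inside \<open>R\<close>, so that their v-closure is \<open>R\<close>.\<close>

lemma v_op_InvI:
  assumes L: "L \<subseteq> carrier K" and d: "d \<in> R" "d \<noteq> \<zero>" "\<And>x. x \<in> L \<Longrightarrow> d \<otimes> x \<in> R"
    and D: "D \<subseteq> carrier K" and LD: "\<And>x e. x \<in> L \<Longrightarrow> e \<in> D \<Longrightarrow> x \<otimes> e \<in> R"
    and gen: "\<And>y. y \<in> carrier K \<Longrightarrow> (\<And>x e. x \<in> L \<Longrightarrow> e \<in> D \<Longrightarrow> y \<otimes> (x \<otimes> e) \<in> R) \<Longrightarrow> y \<in> R"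
  shows "v_op K R L \<in> carrier (Inv_star K R (v_op K R))"
proof -
  let ?P = "v_op K R L \<cdot>\<^bsub>K\<^esub> colon K R (v_op K R L)"
  have sub: "?P \<subseteq> R"
  proof (rule subsetI, erule prod_mem)
    fix i j assume "i \<in> v_op K R L" "j \<in> colon K R (v_op K R L)"
    then show "i \<otimes> j \<in> R" using m_comm[of i j] by (auto simp: mem_v_op mem_colon)
  qed auto
  have DD: "D \<subseteq> colon K R L"
  proof
    fix e assume e: "e \<in> D"
    have "e \<otimes> x \<in> R" if "x \<in> L" for x using LD[OF that e] m_comm[of x e] subsetD[OF L that] subsetD[OF D e] by simp
    then show "e \<in> colon K R L" using e D by (auto simp: mem_colon)
  qed
  have "colon K R ?P = R"
  proof
    show "R \<subseteq> colon K R ?P" using subsetD[OF sub] by (auto simp: mem_colon)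
    show "colon K R ?P \<subseteq> R"
    proof
      fix y assume y: "y \<in> colon K R ?P"
      then have yc: "y \<in> carrier K" by (simp add: mem_colon)
      show "y \<in> R"
      proof (rule gen[OF yc])
        fix x e assume "x \<in> L" "e \<in> D"
        then have "x \<otimes> e \<in> ?P" using v_op_incl[OF L] DD colon_v_op[OF L] by (auto intro!: ideal_prod.prod)
        then show "y \<otimes> (x \<otimes> e) \<in> R" using y by (auto simp: mem_colon)
      qed
    qed
  qed
  then have "v_op K R ?P = R" by (simp add: v_op_def colon_R)
  moreover have "v_op K R L \<in> fractional_ideals K R"
  proof (rule fractionalI[OF _ d(1,2)])
    show "subalgebra R (v_op K R L) K" unfolding v_op_def
      by (rule submodule_colon[OF submodule_R]) (auto simp: mem_colon)
    show "d \<otimes> i \<in> R" if "i \<in> v_op K R L" for i using v_op_colonD(2)[OF that] d by auto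
  qed
  ultimately show ?thesis unfolding Inv_star_def star_invertible_def using v_op_idem[OF L] by simp
qed

section \<open>Ideals and maximal ideals of \<open>R\<close>\<close>

lemma submodule_ideal:
  assumes I: "subalgebra R I K" and sub: "I \<subseteq> R"
  shows "ideal I (K\<lparr>carrier := R\<rparr>)"
proof (rule idealI)
  note I' = submoduleD[OF I]
  show "ring (K\<lparr>carrier := R\<rparr>)" by (rule subring_is_ring[OF subring_R])
  have "subgroup I ((add_monoid K)\<lparr>carrier := R\<rparr>)"
    using add.subgroup_incl[OF _ _ sub] subalgebra.axioms(1)[OF I] subring.axioms(1)[OF subring_R] by blast
  then show "subgroup I (add_monoid (K\<lparr>carrier := R\<rparr>))" by simp
  fix a x assume ax: "a \<in> I" "x \<in> carrier (K\<lparr>carrier := R\<rparr>)"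
  then show "x \<otimes>\<^bsub>K\<lparr>carrier := R\<rparr>\<^esub> a \<in> I" using I' by simp
  then show "a \<otimes>\<^bsub>K\<lparr>carrier := R\<rparr>\<^esub> x \<in> I" using ax I'(1) m_comm[of a x] by auto
qed

lemma ideal_submodule:
  assumes "ideal I (K\<lparr>carrier := R\<rparr>)"
  shows "subalgebra R I K" "I \<subseteq> R"
proof -
  note add_sub = ideal.axioms(1)[OF assms]
  show sub: "I \<subseteq> R" using additive_subgroup.a_subset[OF add_sub] by simp
  show "subalgebra R I K"
  proof (rule submoduleI)
    show "\<zero> \<in> I" using additive_subgroup.zero_closed[OF add_sub] by simp
    show "a \<oplus> b \<in> I" if "a \<in> I" "b \<in> I" for a b using additive_subgroup.a_closed[OF add_sub that] by simp
    show "r \<otimes> a \<in> I" if "r \<in> R" "a \<in> I" for r a using ideal.I_l_closed[OF assms, of a r] that by simp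
  qed (use sub in auto)
qed

lemma MaxD:
  assumes "M \<in> Max_spec K R"
  shows "subalgebra R M K" "M \<subseteq> R" "\<one> \<notin> M"
    "\<And>a b. a \<in> R \<Longrightarrow> b \<in> R \<Longrightarrow> a \<otimes> b \<in> M \<Longrightarrow> a \<in> M \<or> b \<in> M"
    "\<And>J. subalgebra R J K \<Longrightarrow> M \<subseteq> J \<Longrightarrow> J \<subseteq> R \<Longrightarrow> J = M \<or> J = R"
proof -
  have m: "maximalideal M (K\<lparr>carrier := R\<rparr>)" using assms by (simp add: Max_spec_def)
  have "domain (K\<lparr>carrier := R\<rparr>)" by (rule subring_is_domain[OF subring_R])
  then have p: "primeideal M (K\<lparr>carrier := R\<rparr>)" using cring.maximalideal_prime[OF _ m] domain.axioms(1) by blast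
  show sub: "subalgebra R M K" and MR: "M \<subseteq> R" using ideal_submodule[OF maximalideal.axioms(1)[OF m]] by auto
  show "\<one> \<notin> M"
  proof
    assume "\<one> \<in> M"
    then have "R \<subseteq> M" using submoduleD(4)[OF sub, of _ \<one>] by auto
    then show False using maximalideal.I_notcarr[OF m] MR by auto
  qed
  show "\<And>a b. a \<in> R \<Longrightarrow> b \<in> R \<Longrightarrow> a \<otimes> b \<in> M \<Longrightarrow> a \<in> M \<or> b \<in> M"
    using primeideal.I_prime[OF p] by simp
  show "\<And>J. subalgebra R J K \<Longrightarrow> M \<subseteq> J \<Longrightarrow> J \<subseteq> R \<Longrightarrow> J = M \<or> J = R"
    using maximalideal.I_maximal[OF m submodule_ideal] by simp
qed

lemma Max_compl_mult: "M \<in> Max_spec K R \<Longrightarrow> s \<in> R - M \<Longrightarrow> t \<in> R - M \<Longrightarrow> s \<otimes> t \<in> R - M"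
  and Max_carr: "M \<in> Max_spec K R \<Longrightarrow> m \<in> M \<Longrightarrow> m \<in> carrier K"
  and Max_R: "M \<in> Max_spec K R \<Longrightarrow> m \<in> M \<Longrightarrow> m \<in> R"
  and Max_one: "M \<in> Max_spec K R \<Longrightarrow> \<one> \<in> R - M"
  and Max_zero: "M \<in> Max_spec K R \<Longrightarrow> \<zero> \<in> M"
  and Max_mult: "M \<in> Max_spec K R \<Longrightarrow> m \<in> M \<Longrightarrow> r \<in> R \<Longrightarrow> m \<otimes> r \<in> M"
proof -
  have 1: "M \<in> Max_spec K R \<Longrightarrow> r \<in> R \<Longrightarrow> m \<in> M \<Longrightarrow> r \<otimes> m \<in> M" using MaxD(1) submoduleD(4) by blast
  show "M \<in> Max_spec K R \<Longrightarrow> s \<in> R - M \<Longrightarrow> t \<in> R - M \<Longrightarrow> s \<otimes> t \<in> R - M" using MaxD(4) by auto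
  show 2: "M \<in> Max_spec K R \<Longrightarrow> m \<in> M \<Longrightarrow> m \<in> carrier K" using MaxD(2) by auto
  show "M \<in> Max_spec K R \<Longrightarrow> m \<in> M \<Longrightarrow> m \<in> R" using MaxD(2) by auto
  show "M \<in> Max_spec K R \<Longrightarrow> \<one> \<in> R - M" using MaxD(3) by auto
  show "M \<in> Max_spec K R \<Longrightarrow> \<zero> \<in> M" using MaxD(1) submoduleD(2) by auto
  show "M \<in> Max_spec K R \<Longrightarrow> m \<in> M \<Longrightarrow> r \<in> R \<Longrightarrow> m \<otimes> r \<in> M" using 1 2 m_comm[of m r] by auto
qed

text \<open>Zorn's lemma is applied to the submodules of \<open>R\<close> above \<open>I\<close>
  that omit \<open>\<one>\<close>. A maximal one is a maximal ideal, because an ideal containing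
  \<open>\<one>\<close> is all of \<open>R\<close>.\<close>

lemma ex_Max:
  assumes I: "subalgebra R I K" "I \<subseteq> R" "\<one> \<notin> I"
  obtains M where "M \<in> Max_spec K R" "I \<subseteq> M"
proof -
  let ?A = "{J. subalgebra R J K \<and> I \<subseteq> J \<and> J \<subseteq> R \<and> \<one> \<notin> J}"
  have "\<exists>M\<in>?A. \<forall>L\<in>?A. M \<subseteq> L \<longrightarrow> L = M"
  proof (rule subset_Zorn_nonempty)
    show "?A \<noteq> {}" using I by auto
    fix C assume C: "C \<noteq> {}" "subset.chain ?A C"
    then have CA: "C \<subseteq> ?A" and ch: "\<And>L Y. L \<in> C \<Longrightarrow> Y \<in> C \<Longrightarrow> L \<subseteq> Y \<or> Y \<subseteq> L"
      by (auto simp: subset_chain_def)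
    have "subalgebra R (\<Union>C) K"
    proof (rule submoduleI)
      have subs: "subalgebra R L K" if "L \<in> C" for L using that CA by auto
      show "\<Union>C \<subseteq> carrier K" using submoduleD(1)[OF subs] by blast
      show "\<zero> \<in> \<Union>C" using submoduleD(2)[OF subs] C(1) by blast
      show "r \<otimes> a \<in> \<Union>C" if "r \<in> R" "a \<in> \<Union>C" for r a using submoduleD(4)[OF subs] that by blast
      fix a b assume "a \<in> \<Union>C" "b \<in> \<Union>C"
      then obtain L Y where "L \<in> C" "Y \<in> C" "a \<in> L" "b \<in> Y" by blast
      then obtain Z where "Z \<in> C" "a \<in> Z" "b \<in> Z" using ch by blast
      then show "a \<oplus> b \<in> \<Union>C" using submoduleD(3)[OF subs] by blast
    qed
    then show "\<Union>C \<in> ?A" using CA C(1) by blast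
  qed
  then obtain M where M: "M \<in> ?A" and max: "\<forall>L\<in>?A. M \<subseteq> L \<longrightarrow> L = M" by (rule bexE)
  have "maximalideal M (K\<lparr>carrier := R\<rparr>)"
  proof (rule maximalidealI)
    show "ideal M (K\<lparr>carrier := R\<rparr>)" using M submodule_ideal by auto
    show "carrier (K\<lparr>carrier := R\<rparr>) \<noteq> M" using M by auto
    fix J assume J: "ideal J (K\<lparr>carrier := R\<rparr>)" "M \<subseteq> J"
    note J' = ideal_submodule[OF J(1)]
    show "J = M \<or> J = carrier (K\<lparr>carrier := R\<rparr>)"
    proof (cases "\<one> \<in> J")
      case True
      then have "R \<subseteq> J" using submoduleD(4)[OF J'(1), of _ \<one>] by auto
      then show ?thesis using J' by auto
    next
      case False
      then have "J \<in> ?A" using J' J(2) M by auto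
      then show ?thesis using max J(2) by blast
    qed
  qed
  then show ?thesis using that M by (auto simp: Max_spec_def)
qed

text \<open>The elements of \<open>R\<close> that multiply \<open>x\<close> into \<open>I\<close>
  form an ideal. By the local hypothesis it lies in no maximal ideal, so it contains
  \<open>\<one>\<close>.\<close>

lemma local_global:
  assumes I: "subalgebra R I K" and x: "x \<in> carrier K"
    and loc: "\<And>M. M \<in> Max_spec K R \<Longrightarrow> \<exists>s \<in> R - M. s \<otimes> x \<in> I"
  shows "x \<in> I"
proof (rule ccontr)
  assume xI: "x \<notin> I"
  note I' = submoduleD[OF I]
  let ?J = "{s \<in> R. s \<otimes> x \<in> I}"
  have "subalgebra R ?J K"
  proof (rule submoduleI)
    show "\<zero> \<in> ?J" using x I' by auto
    show "a \<oplus> b \<in> ?J" if "a \<in> ?J" "b \<in> ?J" for a b using that x I'(3) by (simp add: l_distr)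
    show "r \<otimes> a \<in> ?J" if "r \<in> R" "a \<in> ?J" for r a using that x I'(4) by (simp add: m_assoc)
  qed auto
  then obtain M where "M \<in> Max_spec K R" "?J \<subseteq> M" by (rule ex_Max) (use x xI in auto)
  then show False using loc by blast
qed

section \<open>Localizations at maximal ideals\<close>

lemma mem_loc:
  assumes M: "M \<in> Max_spec K R"
  shows "x \<in> localization K R M \<longleftrightarrow> x \<in> carrier K \<and> (\<exists>s \<in> R - M. s \<otimes> x \<in> R)"
proof
  assume "x \<in> localization K R M"
  then obtain a s where as: "x = a \<otimes> inv s" "a \<in> R" "s \<in> R - M" by (auto simp: localization_def)
  have s: "s \<in> carrier K" "s \<noteq> \<zero>" using as Max_zero[OF M] by auto
  have "s \<otimes> x = s \<otimes> inv s \<otimes> a" unfolding as(1) using inv_nz(1)[OF s] as s by (simp add: m_ac)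
  then have "s \<otimes> x = a" using s as by simp
  then have "s \<otimes> x \<in> R" using as by simp
  moreover have "x \<in> carrier K" unfolding as(1) using as s by simp
  ultimately show "x \<in> carrier K \<and> (\<exists>s \<in> R - M. s \<otimes> x \<in> R)" using as(3) by blast
next
  assume "x \<in> carrier K \<and> (\<exists>s \<in> R - M. s \<otimes> x \<in> R)"
  then obtain s where x: "x \<in> carrier K" and s': "s \<in> R - M" "s \<otimes> x \<in> R" by blast
  have s: "s \<in> carrier K" "s \<noteq> \<zero>" using s' Max_zero[OF M] by auto
  have "x = (s \<otimes> x) \<otimes> inv s" using x s by (simp add: m_comm[of s x] m_assoc)
  then show "x \<in> localization K R M" unfolding localization_def using s' by blast
qed

lemma loc_carr: "M \<in> Max_spec K R \<Longrightarrow> x \<in> localization K R M \<Longrightarrow> x \<in> carrier K"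
  by (simp add: mem_loc)

lemma R_loc: "M \<in> Max_spec K R \<Longrightarrow> x \<in> R \<Longrightarrow> x \<in> localization K R M"
proof -
  assume M: "M \<in> Max_spec K R" and x: "x \<in> R"
  have "\<one> \<otimes> x \<in> R" using x by simp
  then show "x \<in> localization K R M" using Max_one[OF M] x unfolding mem_loc[OF M] by blast
qed

lemma subring_loc:
  assumes M: "M \<in> Max_spec K R"
  shows "subring (localization K R M) K"
proof (rule subringI)
  show "localization K R M \<subseteq> carrier K" using loc_carr[OF M] by auto
  show "\<one> \<in> localization K R M" using R_loc[OF M] by auto
  fix h assume h: "h \<in> localization K R M"
  then obtain s where hc: "h \<in> carrier K" and s: "s \<in> R - M" "s \<otimes> h \<in> R" using mem_loc[OF M] by blast
  have "s \<otimes> \<ominus> h = \<ominus> (s \<otimes> h)" using hc s by (simp add: r_minus)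
  then show "\<ominus> h \<in> localization K R M" using hc s mem_loc[OF M] R_neg by (metis a_inv_closed)
next
  fix h k assume h: "h \<in> localization K R M" and k: "k \<in> localization K R M"
  obtain s where hc: "h \<in> carrier K" and s: "s \<in> R - M" "s \<otimes> h \<in> R" using h mem_loc[OF M] by blast
  obtain t where kc: "k \<in> carrier K" and t: "t \<in> R - M" "t \<otimes> k \<in> R" using k mem_loc[OF M] by blast
  have st: "s \<otimes> t \<in> R - M" using Max_compl_mult[OF M] s t by blast
  have stc: "s \<in> carrier K" "t \<in> carrier K" "s \<in> R" "t \<in> R" using s t by auto
  have "s \<otimes> t \<otimes> (h \<otimes> k) = (s \<otimes> h) \<otimes> (t \<otimes> k)" using hc kc stc by (simp add: m_ac)
  then have "s \<otimes> t \<otimes> (h \<otimes> k) \<in> R" using s t by simp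
  then show "h \<otimes> k \<in> localization K R M" using hc kc st mem_loc[OF M] by blast
  have "s \<otimes> t \<otimes> (h \<oplus> k) = t \<otimes> (s \<otimes> h) \<oplus> s \<otimes> (t \<otimes> k)" using hc kc stc by (simp add: m_ac r_distr)
  then have "s \<otimes> t \<otimes> (h \<oplus> k) \<in> R" using s t by simp
  then show "h \<oplus> k \<in> localization K R M" using hc kc st mem_loc[OF M] by blast
qed

lemma qdomain_loc:
  assumes M: "M \<in> Max_spec K R"
  shows "qdomain K (localization K R M)"
proof -
  have "carrier K = {a \<otimes> inv b | a b. a \<in> localization K R M \<and> b \<in> localization K R M - {\<zero>}}" (is "_ = ?S")
  proof
    have "carrier K = {a \<otimes> inv b | a b. a \<in> R \<and> b \<in> R - {\<zero>}}" by (rule carrier_quot)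
    also have "\<dots> \<subseteq> ?S" using R_loc[OF M] by blast
    finally show "carrier K \<subseteq> ?S" .
    have "a \<otimes> inv b \<in> carrier K" if "a \<in> localization K R M" "b \<in> localization K R M - {\<zero>}" for a b
      using that loc_carr[OF M] by simp
    then show "?S \<subseteq> carrier K" by blast
  qed
  then show ?thesis using subring_loc[OF M] field_axioms by (intro qdomain.intro qdomain_axioms.intro)
qed

lemma loc_submodule_R:
  assumes M: "M \<in> Max_spec K R" and I: "subalgebra (localization K R M) I K"
  shows "subalgebra R I K"
proof -
  interpret V: qdomain K "localization K R M" by (rule qdomain_loc[OF M])
  show ?thesis using V.submoduleD[OF I] R_loc[OF M] by (intro submoduleI) auto
qed

text \<open>Clearing the denominator \<open>t\<close> of \<open>x\<close> would put
  \<open>t \<otimes> s\<close> into \<open>M\<close>, although neither factor lies there. In other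
  words, elements of \<open>M\<close> are non-units of the localization.\<close>

lemma max_not_unit:
  assumes M: "M \<in> Max_spec K R" and x: "x \<in> localization K R M" and m: "m \<in> M" and s: "s \<in> R - M"
  shows "m \<otimes> x \<noteq> s"
proof
  assume e: "m \<otimes> x = s"
  obtain t where xc: "x \<in> carrier K" and t: "t \<in> R - M" "t \<otimes> x \<in> R" using x mem_loc[OF M] by blast
  have "m \<in> carrier K" using Max_carr[OF M m] .
  then have "t \<otimes> s = m \<otimes> (t \<otimes> x)" unfolding e[symmetric] using xc t by (simp add: m_ac)
  then have "t \<otimes> s \<in> M" using Max_mult[OF M m t(2)] by simp
  then show False using Max_compl_mult[OF M t(1) s] by blast
qed

end

section \<open>Pruefer domains and the valuation property\<close>

locale prufer = qdomain K R for K :: "('a, 'm) ring_scheme" (structure) and R +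
  assumes fin_inv: "\<And>S. finite S \<Longrightarrow> S \<subseteq> R \<Longrightarrow> genideal (K\<lparr>carrier := R\<rparr>) S \<noteq> {\<zero>} \<Longrightarrow>
      star_invertible K R d_op (genideal (K\<lparr>carrier := R\<rparr>) S)"
begin

text \<open>Finitely generated ideals are locally principal: by invertibility, some product of a
  generator \<open>s\<close> with a multiplier \<open>u\<close> of \<open>S\<close> escapes
  \<open>M\<close>. As \<open>u \<otimes> s\<close> is then a unit at \<open>M\<close>, the element
  \<open>s\<close> generates \<open>S\<close> locally.\<close>

lemma finite_unit:
  assumes M: "M \<in> Max_spec K R" and S: "finite S" "S \<subseteq> R" "x \<in> S" "x \<noteq> \<zero>"
  obtains s u where "s \<in> S" "u \<in> carrier K" "\<And>t. t \<in> S \<Longrightarrow> u \<otimes> t \<in> R" "u \<otimes> s \<in> R - M"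
proof -
  note RR = subring_is_ring[OF subring_R]
  define B where "B = genideal (K\<lparr>carrier := R\<rparr>) S"
  have SB: "S \<subseteq> B" using ring.genideal_self[OF RR] S unfolding B_def by simp
  have "B \<noteq> {\<zero>}" using SB S by auto
  then have inv: "B \<cdot>\<^bsub>K\<^esub> colon K R B = R" using fin_inv[OF S(1,2)] unfolding B_def star_invertible_def d_op_def by simp
  let ?U = "{u \<in> carrier K. \<forall>t\<in>S. u \<otimes> t \<in> R}"
  \<comment> \<open>If every product stayed in \<open>M\<close>, the ideal \<open>?J\<close> would
    contain \<open>S\<close>, hence \<open>B\<close>, and \<open>B (R : B)\<close> would lie in
    \<open>M\<close>.\<close>
  let ?J = "{x \<in> R. \<forall>u\<in>?U. u \<otimes> x \<in> M}"
  have "\<exists>s\<in>S. \<exists>u\<in>?U. u \<otimes> s \<notin> M"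
  proof (rule ccontr)
    assume "\<not> (\<exists>s\<in>S. \<exists>u\<in>?U. u \<otimes> s \<notin> M)"
    then have SJ: "S \<subseteq> ?J" using S by auto
    note Mm = submoduleD[OF MaxD(1)[OF M]]
    have "subalgebra R ?J K"
    proof (rule submoduleI)
      show "?J \<subseteq> carrier K" by auto
      show "\<zero> \<in> ?J" using Mm by auto
      show "a \<oplus> b \<in> ?J" if "a \<in> ?J" "b \<in> ?J" for a b
      proof -
        have "u \<otimes> (a \<oplus> b) \<in> M" if u: "u \<in> ?U" for u
        proof -
          have "u \<otimes> (a \<oplus> b) = u \<otimes> a \<oplus> u \<otimes> b" using u \<open>a \<in> ?J\<close> \<open>b \<in> ?J\<close> by (intro r_distr) auto
          then show ?thesis using u \<open>a \<in> ?J\<close> \<open>b \<in> ?J\<close> Mm(3) by auto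
        qed
        then show ?thesis using that by auto
      qed
      show "r \<otimes> a \<in> ?J" if "r \<in> R" "a \<in> ?J" for r a
      proof -
        have "u \<otimes> (r \<otimes> a) \<in> M" if u: "u \<in> ?U" for u
        proof -
          have "u \<otimes> (r \<otimes> a) = r \<otimes> (u \<otimes> a)" using u \<open>a \<in> ?J\<close> \<open>r \<in> R\<close> by (intro m_lcomm) auto
          then show ?thesis using u \<open>a \<in> ?J\<close> \<open>r \<in> R\<close> Mm(4) by auto
        qed
        then show ?thesis using that by auto
      qed
    qed
    then have "ideal ?J (K\<lparr>carrier := R\<rparr>)" by (rule submodule_ideal) auto
    then have BJ: "B \<subseteq> ?J" unfolding B_def by (rule ring.genideal_minimal[OF RR _ SJ])
    have "B \<cdot>\<^bsub>K\<^esub> colon K R B \<subseteq> M"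
    proof (rule subsetI, erule prod_mem)
      fix b u assume b: "b \<in> B" and u: "u \<in> colon K R B"
      have "u \<in> ?U" using u SB by (auto simp: mem_colon)
      then have "u \<otimes> b \<in> M" "u \<in> carrier K" using b BJ by auto
      moreover have "b \<in> carrier K" using b BJ by auto
      ultimately show "b \<otimes> u \<in> M" using m_comm[of b u] by simp
    qed (rule Mm(3))
    then show False using inv MaxD(3)[OF M] by auto
  qed
  then show ?thesis using that by blast
qed

text \<open>The localization is a valuation ring: the inverse of \<open>x\<close> lies in its
  maximal ideal. For the ideal generated by \<open>b\<close> and \<open>b \<otimes> x\<close>, with
  \<open>b\<close> a denominator of \<open>x\<close>, the local generator cannot be
  \<open>b\<close>, since that would put \<open>x\<close> into the localization.\<close>

lemma valuation:
  assumes M: "M \<in> Max_spec K R" and x: "x \<in> carrier K" "x \<notin> localization K R M"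
  obtains m where "m \<in> M" "m \<otimes> x \<in> R - M"
proof -
  obtain b where b: "b \<in> R" "b \<noteq> \<zero>" "b \<otimes> x \<in> R" by (rule denominator[OF x(1)])
  obtain s u where su: "s \<in> {b, b \<otimes> x}" "u \<in> carrier K" "\<And>t. t \<in> {b, b \<otimes> x} \<Longrightarrow> u \<otimes> t \<in> R" "u \<otimes> s \<in> R - M"
    by (rule finite_unit[OF M, of "{b, b \<otimes> x}" b]) (use b in auto)
  have e: "u \<otimes> b \<otimes> x = u \<otimes> (b \<otimes> x)" using su(2) b x by (simp add: m_assoc)
  have R: "u \<otimes> b \<in> R" "u \<otimes> b \<otimes> x \<in> R" using su(3) e by auto
  have m: "u \<otimes> b \<in> M"
  proof (rule ccontr)
    assume "u \<otimes> b \<notin> M"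
    then have "x \<in> localization K R M" using R x mem_loc[OF M] by blast
    then show False using x by simp
  qed
  then have "u \<otimes> b \<otimes> x \<in> R - M" using su(1,4) e by auto
  then show ?thesis using that[OF m] by simp
qed

text \<open>Over a valuation ring a module differs from its v-closure by at most the maximal ideal.
  If \<open>x \<otimes> m\<close> were not in \<open>I\<close> locally, its inverse would multiply
  \<open>I\<close> into the localization, by the valuation property. Then \<open>x\<close> times
  that inverse would lie there too, making \<open>m\<close> a unit.\<close>

lemma v_op_near:
  assumes M: "M \<in> Max_spec K R" and I: "subalgebra R I K"
    and x: "x \<in> v_op K (localization K R M) I" and m: "m \<in> M"
  obtains s where "s \<in> R - M" "s \<otimes> (x \<otimes> m) \<in> I"
proof -
  interpret V: qdomain K "localization K R M" by (rule qdomain_loc[OF M])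
  have xc: "x \<in> carrier K" using x by (simp add: V.mem_v_op)
  have mc: "m \<in> carrier K" by (rule Max_carr[OF M m])
  note I' = submoduleD[OF I]
  have "\<exists>s\<in>R - M. s \<otimes> (x \<otimes> m) \<in> I"
  proof (rule ccontr)
    assume no: "\<not> (\<exists>s\<in>R - M. s \<otimes> (x \<otimes> m) \<in> I)"
    have n0: "x \<otimes> m \<noteq> \<zero>" using no I'(2) Max_one[OF M] by fastforce
    let ?y = "inv (x \<otimes> m)"
    have y: "?y \<in> carrier K" using n0 xc mc by simp
    have "?y \<otimes> i \<in> localization K R M" if i: "i \<in> I" for i
    proof (rule ccontr)
      assume "?y \<otimes> i \<notin> localization K R M"
      then obtain n where n: "n \<in> M" "n \<otimes> (?y \<otimes> i) \<in> R - M" using valuation[OF M, of "?y \<otimes> i"] y i I' by blast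
      have ic: "i \<in> carrier K" and nc: "n \<in> carrier K" using i I' n Max_carr[OF M] by auto
      have "n \<otimes> (?y \<otimes> i) \<otimes> (x \<otimes> m) = n \<otimes> i \<otimes> (?y \<otimes> (x \<otimes> m))" using y ic nc xc mc by (simp add: m_ac)
      also have "\<dots> = n \<otimes> i" using n0 xc mc ic nc by simp
      finally have "n \<otimes> (?y \<otimes> i) \<otimes> (x \<otimes> m) \<in> I" using I'(4) n(1) Max_R[OF M] i by simp
      then show False using no n by blast
    qed
    then have xy: "x \<otimes> ?y \<in> localization K R M" by (rule V.v_op_colonD(1)[OF x y])
    have "m \<otimes> (x \<otimes> ?y) = x \<otimes> m \<otimes> ?y" using y xc mc by (simp add: m_ac)
    then have "m \<otimes> (x \<otimes> ?y) = \<one>" using n0 xc mc by simp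
    then show False using max_not_unit[OF M xy m Max_one[OF M]] by simp
  qed
  then show ?thesis using that by blast
qed

end

section \<open>Finite character: elements with a pole at one maximal ideal\<close>

locale lf_prufer = prufer K R for K :: "('a, 'm) ring_scheme" (structure) and R +
  assumes lf: "locally_finite K R"
begin

text \<open>Only finitely many \<open>N \<noteq> M\<close> contain \<open>m\<close>. An element of
  \<open>M\<close> outside each of them, together with \<open>m\<close>, generates an ideal
  contained in no maximal ideal but \<open>M\<close>. A multiplier of these generators that makes
  one of them a unit at \<open>M\<close> has a pole at \<open>M\<close>, while at \<open>N\<close>
  some generator is a unit and clears it.\<close>

lemma pole_only_at:
  assumes M: "M \<in> Max_spec K R" and m: "m \<in> M" "m \<noteq> \<zero>"
  obtains w where "w \<in> carrier K" "w \<otimes> m \<in> R" "w \<notin> localization K R M"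
    "\<And>N. N \<in> Max_spec K R \<Longrightarrow> N \<noteq> M \<Longrightarrow> w \<in> localization K R N"
proof -
  let ?F = "{N \<in> Max_spec K R. m \<in> N} - {M}"
  have "finite {N \<in> Max_spec K R. m \<in> N}" using lf m Max_R[OF M] unfolding locally_finite_def by auto
  then have fin: "finite ?F" by simp
  have "\<exists>c. c \<in> M \<and> c \<notin> N" if N: "N \<in> ?F" for N
  proof (rule ccontr)
    assume "\<nexists>c. c \<in> M \<and> c \<notin> N"
    then have MN: "M \<subseteq> N" by blast
    have N': "N \<in> Max_spec K R" "N \<noteq> M" using N by auto
    have "N = M \<or> N = R" using MaxD(5)[OF M MaxD(1)[OF N'(1)] MN MaxD(2)[OF N'(1)]] .
    then show False using N' MaxD(3)[OF N'(1)] by auto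
  qed
  then obtain c where c: "\<And>N. N \<in> ?F \<Longrightarrow> c N \<in> M \<and> c N \<notin> N" by metis
  let ?S = "insert m (c ` ?F)"
  have SM: "?S \<subseteq> M" using m c by auto
  obtain s u where su: "s \<in> ?S" "u \<in> carrier K" "\<And>t. t \<in> ?S \<Longrightarrow> u \<otimes> t \<in> R" "u \<otimes> s \<in> R - M"
    by (rule finite_unit[OF M, of ?S m]) (use fin SM m MaxD(2)[OF M] in auto)
  show ?thesis
  proof (rule that[OF su(2)])
    show "u \<otimes> m \<in> R" using su(3) by blast
    have sM: "s \<in> M" using su(1) SM by blast
    show "u \<notin> localization K R M"
    proof
      assume u: "u \<in> localization K R M"
      have "s \<otimes> u = u \<otimes> s" using su(2) sM Max_carr[OF M] m_comm by blast
      then show False using max_not_unit[OF M u sM su(4)] by simp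
    qed
    fix N assume N: "N \<in> Max_spec K R" "N \<noteq> M"
    obtain t where t: "t \<in> ?S" "t \<notin> N"
    proof (cases "m \<in> N")
      case True then show ?thesis using N c[of N] that[of "c N"] by blast
    next
      case False then show ?thesis using that by blast
    qed
    then have tR: "t \<in> R - N" using SM MaxD(2)[OF M] by blast
    have "u \<otimes> t \<in> R" using su(3) t by blast
    then have "t \<otimes> u \<in> R" using m_comm[of t u] su(2) tR by auto
    then show "u \<in> localization K R N" using mem_loc[OF N(1)] su(2) tR by blast
  qed
qed

text \<open>A counterexample \<open>y\<close> at \<open>M\<close> is traded for a global one:
  \<open>w\<close> multiplies \<open>A\<close> into \<open>R\<close>. At \<open>M\<close> this holds
  because \<open>m \<otimes> y\<close> is a unit and \<open>w \<otimes> m \<in> R\<close>; elsewhere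
  \<open>w\<close> has no pole. So \<open>w \<in> R\<close>, against its pole at
  \<open>M\<close>.\<close>

lemma local_colon:
  assumes A: "A \<subseteq> R" and AR: "colon K R A \<subseteq> R" and M: "M \<in> Max_spec K R"
    and y: "y \<in> carrier K" and yA: "\<And>a. a \<in> A \<Longrightarrow> y \<otimes> a \<in> localization K R M"
  shows "y \<in> localization K R M"
proof (rule ccontr)
  assume "y \<notin> localization K R M"
  then obtain m where m: "m \<in> M" "m \<otimes> y \<in> R - M" using valuation[OF M y] by blast
  have m0: "m \<noteq> \<zero>" using m Max_zero[OF M] y by auto
  have mc: "m \<in> carrier K" by (rule Max_carr[OF M m(1)])
  obtain w where w: "w \<in> carrier K" "w \<otimes> m \<in> R" "w \<notin> localization K R M"
    "\<And>N. N \<in> Max_spec K R \<Longrightarrow> N \<noteq> M \<Longrightarrow> w \<in> localization K R N" using pole_only_at[OF M m(1) m0] by blast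
  have "w \<otimes> a \<in> R" if a: "a \<in> A" for a
  proof (rule local_global[OF submodule_R])
    have aR: "a \<in> R" using a A by auto
    show "w \<otimes> a \<in> carrier K" using w aR by auto
    fix N assume N: "N \<in> Max_spec K R"
    show "\<exists>s\<in>R - N. s \<otimes> (w \<otimes> a) \<in> R"
    proof (cases "N = M")
      case True
      obtain t where t: "t \<in> R - M" "t \<otimes> (y \<otimes> a) \<in> R" using yA[OF a] mem_loc[OF M] by blast
      have "t \<otimes> (m \<otimes> y) \<otimes> (w \<otimes> a) = (w \<otimes> m) \<otimes> (t \<otimes> (y \<otimes> a))" using t mc y w aR by (simp add: m_ac)
      then have "t \<otimes> (m \<otimes> y) \<otimes> (w \<otimes> a) \<in> R" using w t by simp
      then show ?thesis using Max_compl_mult[OF M t(1) m(2)] True by blast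
    next
      case False
      obtain t where t: "t \<in> R - N" "t \<otimes> w \<in> R" using w(4)[OF N False] mem_loc[OF N] by blast
      have "t \<otimes> (w \<otimes> a) = t \<otimes> w \<otimes> a" using t w aR by (simp add: m_assoc)
      then have "t \<otimes> (w \<otimes> a) \<in> R" using t aR by simp
      then show ?thesis using t by blast
    qed
  qed
  then have "w \<in> R" using AR w by (auto simp: mem_colon)
  then show False using w(3) R_loc[OF M] by blast
qed

end

section \<open>The local components of a star-invertible ideal\<close>

context qdomain
begin

text \<open>The closures are treated one factor at a time: \<open>y \<otimes> i\<close> multiplies
  \<open>J\<close>, hence its v-closure, into \<open>R\<close>; then \<open>y \<otimes> b\<close>
  does the same for \<open>I\<close>.\<close>

lemma colon_prod_v_op:
  assumes I: "I \<subseteq> carrier K" and J: "J \<subseteq> carrier K"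
  shows "colon K R (v_op K R I \<cdot>\<^bsub>K\<^esub> v_op K R J) = colon K R (I \<cdot>\<^bsub>K\<^esub> J)"
proof
  have vc: "v_op K R I \<subseteq> carrier K" "v_op K R J \<subseteq> carrier K" by (auto simp: mem_v_op)
  have "i \<otimes> j \<in> v_op K R I \<cdot>\<^bsub>K\<^esub> v_op K R J" if "i \<in> I" "j \<in> J" for i j
    using v_op_incl[OF I] v_op_incl[OF J] that by (blast intro: ideal_prod.prod)
  then have "I \<cdot>\<^bsub>K\<^esub> J \<subseteq> v_op K R I \<cdot>\<^bsub>K\<^esub> v_op K R J" by (intro subsetI) (erule prod_mem, rule ideal_prod.sum)
  then show "colon K R (v_op K R I \<cdot>\<^bsub>K\<^esub> v_op K R J) \<subseteq> colon K R (I \<cdot>\<^bsub>K\<^esub> J)"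
    by (auto simp only: mem_colon subset_iff)
  show "colon K R (I \<cdot>\<^bsub>K\<^esub> J) \<subseteq> colon K R (v_op K R I \<cdot>\<^bsub>K\<^esub> v_op K R J)"
  proof
    fix y assume y: "y \<in> colon K R (I \<cdot>\<^bsub>K\<^esub> J)"
    then have yc: "y \<in> carrier K" by (simp add: mem_colon)
    have "y \<otimes> p \<in> R" if p: "p \<in> v_op K R I \<cdot>\<^bsub>K\<^esub> v_op K R J" for p
    proof (rule prod_mult_mem[OF p vc yc R_add])
      fix a b assume a: "a \<in> v_op K R I" and b: "b \<in> v_op K R J"
      have ac: "a \<in> carrier K" and bc: "b \<in> carrier K" using a b vc by auto
      have "y \<otimes> b \<otimes> a \<in> R"
      proof (rule v_op_colonD(2)[OF a])
        fix i assume i: "i \<in> I"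
        then have ic: "i \<in> carrier K" using I by auto
        have "y \<otimes> i \<otimes> b \<in> R"
        proof (rule v_op_colonD(2)[OF b])
          fix j assume j: "j \<in> J"
          have "y \<otimes> (i \<otimes> j) \<in> R" using y ideal_prod.prod[OF i j] by (auto simp: mem_colon)
          then show "y \<otimes> i \<otimes> j \<in> R" using yc ic subsetD[OF J j] by (simp add: m_assoc)
        qed (use yc ic in simp)
        then show "y \<otimes> b \<otimes> i \<in> R" using yc ic bc by (simp add: m_ac)
      qed (use yc bc in simp)
      then show "y \<otimes> (a \<otimes> b) \<in> R" using yc ac bc by (simp add: m_ac)
    qed
    then show "y \<in> colon K R (v_op K R I \<cdot>\<^bsub>K\<^esub> v_op K R J)" using yc by (simp add: mem_colon)
  qed
qed

lemma loc_cancel: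
  assumes M: "M \<in> Max_spec K R" and s: "s \<in> R - M" and x: "x \<in> carrier K" and sx: "s \<otimes> x \<in> localization K R M"
  shows "x \<in> localization K R M"
proof -
  obtain t where t: "t \<in> R - M" "t \<otimes> (s \<otimes> x) \<in> R" using sx mem_loc[OF M] by blast
  have "t \<otimes> s \<otimes> x \<in> R" using t s x by (simp add: m_assoc)
  then show ?thesis using Max_compl_mult[OF M t(1) s] x mem_loc[OF M] by blast
qed

text \<open>As \<open>d\<close> multiplies \<open>I\<close> into \<open>R\<close> and
  \<open>d \<otimes> i\<close> is a unit at \<open>M\<close>, the element \<open>i\<close> generates
  \<open>I\<close> locally, and a nonzero principal module is its own v-closure.\<close>

lemma v_op_principal:
  assumes M: "M \<in> Max_spec K R" and I: "I \<subseteq> carrier K" and i: "i \<in> I"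
    and d: "d \<in> carrier K" "\<And>j. j \<in> I \<Longrightarrow> d \<otimes> j \<in> R" "d \<otimes> i \<notin> M"
  shows "v_op K (localization K R M) I \<in> Prin K (localization K R M)"
proof -
  interpret V: qdomain K "localization K R M" by (rule qdomain_loc[OF M])
  have ic: "i \<in> carrier K" using i I by auto
  have di: "d \<otimes> i \<in> R - M" using d i by auto
  have i0: "i \<noteq> \<zero>" using di Max_zero[OF M] d by auto
  have "v_op K (localization K R M) I = i <#\<^bsub>K\<^esub> localization K R M"
  proof
    show "v_op K (localization K R M) I \<subseteq> i <#\<^bsub>K\<^esub> localization K R M"
    proof
      fix x assume x: "x \<in> v_op K (localization K R M) I"
      have xc: "x \<in> carrier K" using x by (simp add: V.mem_v_op)
      have "d \<otimes> x \<in> localization K R M" using d R_loc[OF M] by (intro V.v_op_colonD(2)[OF x]) auto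
      moreover have "d \<otimes> x = d \<otimes> i \<otimes> (inv i \<otimes> x)" using d ic i0 xc by (simp add: m_assoc)
      ultimately have "inv i \<otimes> x \<in> localization K R M" using loc_cancel[OF M di, of "inv i \<otimes> x"] ic i0 xc by simp
      moreover have "x = i \<otimes> (inv i \<otimes> x)" using ic i0 xc by simp
      ultimately show "x \<in> i <#\<^bsub>K\<^esub> localization K R M" by (auto simp: mem_l_coset)
    qed
    show "i <#\<^bsub>K\<^esub> localization K R M \<subseteq> v_op K (localization K R M) I"
    proof
      fix x assume "x \<in> i <#\<^bsub>K\<^esub> localization K R M"
      then obtain r where r: "r \<in> localization K R M" "x = i \<otimes> r" by (auto simp: mem_l_coset)
      have "i \<otimes> r \<otimes> y \<in> localization K R M" if y: "y \<in> carrier K" "\<forall>i\<in>I. y \<otimes> i \<in> localization K R M" for y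
      proof -
        have "r \<otimes> (y \<otimes> i) \<in> localization K R M" using r y i by blast
        moreover have "r \<otimes> (y \<otimes> i) = i \<otimes> r \<otimes> y" using V.R_carr[OF r(1)] y ic by (simp add: m_ac)
        ultimately show ?thesis by simp
      qed
      then show "x \<in> v_op K (localization K R M) I" unfolding r(2) using r ic by (simp add: V.mem_v_op)
    qed
  qed
  then show ?thesis using ic i0 unfolding Prin_def by blast
qed

end

context star_domain
begin

lemma colon_star:
  assumes C: "C \<in> fractional_ideals K R"
  shows "colon K R (star C) = colon K R C"
proof
  show "colon K R (star C) \<subseteq> colon K R C" using star_incl[OF C] by (auto simp only: mem_colon subset_iff)
  have "d \<otimes> x \<in> R" if "d \<in> colon K R C" "x \<in> star C" for d x
    by (rule star_mult[OF C fractional_R star_R _ _ that(2)]) (use that(1) in \<open>auto simp: mem_colon\<close>)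
  then show "colon K R C \<subseteq> colon K R (star C)" by (auto simp: mem_colon)
qed

text \<open>\<open>C\<close> and \<open>star C\<close> have the same colon and the same closed
  products, so invertibility may be tested before closing.\<close>

lemma star_Inv_iff:
  assumes C: "C \<in> fractional_ideals K R" "i \<in> C" "i \<noteq> \<zero>"
  shows "star C \<in> carrier G \<longleftrightarrow> star (C \<cdot>\<^bsub>K\<^esub> colon K R C) = R"
  using star_prod_star_left[OF C(1) fractional_colon[OF C]] colon_star[OF C(1)] star_idem[OF C(1)] star_frac[OF C(1)]
  by (simp add: mem_Inv)

end

section \<open>From star-invertible ideals of \<open>R\<close> to v-ideals of the
  localizations\<close>

locale lf_prufer_star = lf_prufer K R + star_domain K R star
  for K :: "('a, 'm) ring_scheme" (structure) and R and star
begin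

abbreviation "\<Delta> \<equiv> {M \<in> Max_spec K R. M \<noteq> star M}"

lemma Max_frac: "M \<in> Max_spec K R \<Longrightarrow> M \<in> fractional_ideals K R"
  by (rule fractionalI[OF MaxD(1) R_one]) (auto simp: Max_R Max_carr)

lemma star_Max:
  assumes M: "M \<in> \<Delta>"
  shows "star M = R"
proof -
  have M': "M \<in> Max_spec K R" using M by auto
  note f = Max_frac[OF M']
  have "star M \<subseteq> R" by (rule star_subset[OF f fractional_R star_R MaxD(2)[OF M']])
  then show ?thesis using MaxD(5)[OF M' fractionalD(1)[OF star_frac[OF f]] star_incl[OF f]] M by auto
qed

text \<open>The zero ideal is star-closed by homogeneity at \<open>\<zero>\<close>, so it does not
  belong to \<open>\<Delta>\<close>.\<close>

lemma Delta_nonzero: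
  assumes M: "M \<in> \<Delta>"
  obtains m where "m \<in> M" "m \<noteq> \<zero>"
proof -
  have M': "M \<in> Max_spec K R" using M by auto
  have "M \<noteq> {\<zero>}"
  proof
    assume M0: "M = {\<zero>}"
    have "\<zero> <#\<^bsub>K\<^esub> R = {\<zero>}" by (auto simp: mem_l_coset intro!: exI[of _ \<one>])
    then have "star M = {\<zero>}" using star_coset[OF fractional_R, of \<zero>] star_R M0 by auto
    then show False using M M0 by auto
  qed
  then show ?thesis using that Max_zero[OF M'] by blast
qed

text \<open>For nonzero \<open>m \<in> M\<close> the element \<open>inv m\<close> is missing from
  the localization, which is therefore a proper subring of \<open>K\<close>.\<close>

lemma star_domain_loc:
  assumes M: "M \<in> \<Delta>"
  shows "star_domain K (localization K R M) (v_op K (localization K R M))"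
proof -
  have M': "M \<in> Max_spec K R" using M by auto
  obtain m where m: "m \<in> M" "m \<noteq> \<zero>" by (rule Delta_nonzero[OF M])
  have mc: "m \<in> carrier K" by (rule Max_carr[OF M' m(1)])
  have "inv m \<notin> localization K R M" using max_not_unit[OF M' _ m(1) Max_one[OF M'], of "inv m"] m mc by auto
  then have "localization K R M \<noteq> carrier K" using inv_nz(1)[OF mc m(2)] by auto
  then show ?thesis by (rule qdomain.star_domain_v_op[OF qdomain_loc[OF M']])
qed

text \<open>Star-invertibility makes the colon of \<open>I (R : I)\<close> lie in \<open>R\<close>,
  and \<open>local_colon\<close> carries this over to \<open>M\<close>.\<close>

lemma star_invertible_local:
  assumes I: "I \<in> fractional_ideals K R" "star (I \<cdot>\<^bsub>K\<^esub> colon K R I) = R" and M: "M \<in> Max_spec K R"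
    and y: "y \<in> carrier K" and yI: "\<And>i d. i \<in> I \<Longrightarrow> d \<in> colon K R I \<Longrightarrow> y \<otimes> (i \<otimes> d) \<in> localization K R M"
  shows "y \<in> localization K R M"
proof (rule local_colon[OF prod_colon_subset[OF fractionalD(3)[OF I(1)]] _ M y])
  interpret V: qdomain K "localization K R M" by (rule qdomain_loc[OF M])
  note D = colon_frac[OF I]
  show "colon K R (I \<cdot>\<^bsub>K\<^esub> colon K R I) \<subseteq> R"
  proof
    fix z assume z: "z \<in> colon K R (I \<cdot>\<^bsub>K\<^esub> colon K R I)"
    have zp: "z \<in> carrier K" "\<forall>p\<in>I \<cdot>\<^bsub>K\<^esub> colon K R I. z \<otimes> p \<in> R" using z unfolding mem_colon by blast+
    show "z \<in> R" by (rule Inv_gen[OF I fractional_R star_R zp(1)]) (blast intro: zp(2)[rule_format] ideal_prod.prod)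
  qed
  show "y \<otimes> a \<in> localization K R M" if "a \<in> I \<cdot>\<^bsub>K\<^esub> colon K R I" for a
    by (rule prod_mult_mem[OF that fractionalD(3)[OF I(1)] fractionalD(3)[OF D] y V.R_add yI])
qed

text \<open>Over the localization, \<open>I\<close> and the module it generates have the same colon,
  so this is the v-closure of the localized ideal. The elements of \<open>(R : I)\<close> serve as
  multipliers.\<close>

lemma v_op_loc_Inv:
  assumes I: "I \<in> carrier G" and M: "M \<in> Max_spec K R"
  shows "v_op K (localization K R M) I \<in> carrier (Inv_star K (localization K R M) (v_op K (localization K R M)))"
proof -
  interpret V: qdomain K "localization K R M" by (rule qdomain_loc[OF M])
  have I': "I \<in> fractional_ideals K R" "star (I \<cdot>\<^bsub>K\<^esub> colon K R I) = R" using I by (auto simp: mem_Inv)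
  note Ic = fractionalD(3)[OF I'(1)]
  obtain d where d: "d \<in> R" "d \<noteq> \<zero>" "\<forall>i\<in>I. d \<otimes> i \<in> R" using fractionalD(2)[OF I'(1)] by blast
  show ?thesis
  proof (rule V.v_op_InvI[OF Ic R_loc[OF M d(1)] d(2)])
    show "d \<otimes> x \<in> localization K R M" if "x \<in> I" for x using d R_loc[OF M] that by auto
    show "colon K R I \<subseteq> carrier K" by (auto simp: mem_colon)
    show "x \<otimes> e \<in> localization K R M" if "x \<in> I" "e \<in> colon K R I" for x e
      using prod_colon_subset[OF Ic] that R_loc[OF M] by (auto intro!: ideal_prod.prod)
    show "y \<in> localization K R M" if "y \<in> carrier K"
      "\<And>x e. x \<in> I \<Longrightarrow> e \<in> colon K R I \<Longrightarrow> y \<otimes> (x \<otimes> e) \<in> localization K R M" for y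
      using star_invertible_local[OF I' M that] .
  qed
qed

text \<open>If \<open>y\<close> multiplies \<open>C\<close> into the localization and
  \<open>x\<close> lies in \<open>star C\<close>, then \<open>y x (c d)\<close> splits as
  \<open>(y c) (d x)\<close>, where \<open>d x \<in> R\<close> because \<open>C\<close> and
  \<open>star C\<close> have the same colon.\<close>

lemma v_op_loc_star:
  assumes C: "C \<in> fractional_ideals K R" "star (C \<cdot>\<^bsub>K\<^esub> colon K R C) = R" and M: "M \<in> Max_spec K R"
  shows "v_op K (localization K R M) (star C) = v_op K (localization K R M) C"
proof -
  interpret V: qdomain K "localization K R M" by (rule qdomain_loc[OF M])
  have "colon K (localization K R M) (star C) = colon K (localization K R M) C"
  proof
    show "colon K (localization K R M) (star C) \<subseteq> colon K (localization K R M) C"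
      using star_incl[OF C(1)] by (auto simp only: mem_colon subset_iff)
    have "y \<otimes> x \<in> localization K R M" if y: "y \<in> colon K (localization K R M) C" and x: "x \<in> star C" for y x
    proof -
      have yc: "y \<in> carrier K" and xc: "x \<in> carrier K" using y x fractionalD(3)[OF star_frac[OF C(1)]] by (auto simp: mem_colon)
      show ?thesis
      proof (rule star_invertible_local[OF C M])
        fix c d assume c: "c \<in> C" and d: "d \<in> colon K R C"
        have "d \<in> colon K R (star C)" using colon_star[OF C(1)] d by simp
        then have "d \<otimes> x \<in> R" using x by (simp add: mem_colon)
        then have "y \<otimes> c \<otimes> (d \<otimes> x) \<in> localization K R M" using y c R_loc[OF M] by (auto simp: mem_colon)
        moreover have "c \<in> carrier K" "d \<in> carrier K" using c d fractionalD(3)[OF C(1)] by (auto simp: mem_colon)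
        ultimately show "y \<otimes> x \<otimes> (c \<otimes> d) \<in> localization K R M" using yc xc by (simp add: m_ac)
      qed (use xc yc in simp)
    qed
    then show "colon K (localization K R M) C \<subseteq> colon K (localization K R M) (star C)" by (auto simp: mem_colon)
  qed
  then show ?thesis by (rule V.v_op_cong)
qed

lemma v_op_loc_mult:
  assumes I: "I \<in> carrier G" and J: "J \<in> carrier G" and M: "M \<in> Max_spec K R"
  shows "v_op K (localization K R M) (I \<otimes>\<^bsub>G\<^esub> J) =
    v_op K (localization K R M) (v_op K (localization K R M) I \<cdot>\<^bsub>K\<^esub> v_op K (localization K R M) J)"
proof -
  interpret V: qdomain K "localization K R M" by (rule qdomain_loc[OF M])
  have If: "I \<in> fractional_ideals K R" "star (I \<cdot>\<^bsub>K\<^esub> colon K R I) = R" using I by (auto simp: mem_Inv)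
  have Jf: "J \<in> fractional_ideals K R" "star (J \<cdot>\<^bsub>K\<^esub> colon K R J) = R" using J by (auto simp: mem_Inv)
  note IJ = fractional_prod[OF If(1) Jf(1)]
  obtain i j where ij: "i \<in> I" "i \<noteq> \<zero>" "j \<in> J" "j \<noteq> \<zero>" using Inv_nonzero[OF If] Inv_nonzero[OF Jf] by metis
  have "i \<otimes> j \<noteq> \<zero>" using ij fractionalD(3)[OF If(1)] fractionalD(3)[OF Jf(1)] by (auto simp: integral_iff subsetD)
  then have "star (I \<cdot>\<^bsub>K\<^esub> J \<cdot>\<^bsub>K\<^esub> colon K R (I \<cdot>\<^bsub>K\<^esub> J)) = R"
    using star_Inv_iff[OF IJ ideal_prod.prod[OF ij(1,3)]] Inv_star_prod[OF I J] by simp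
  then have "v_op K (localization K R M) (star (I \<cdot>\<^bsub>K\<^esub> J)) = v_op K (localization K R M) (I \<cdot>\<^bsub>K\<^esub> J)"
    by (rule v_op_loc_star[OF IJ _ M])
  also have "\<dots> = v_op K (localization K R M) (v_op K (localization K R M) I \<cdot>\<^bsub>K\<^esub> v_op K (localization K R M) J)"
    by (rule V.v_op_cong) (rule V.colon_prod_v_op[symmetric, OF fractionalD(3)[OF If(1)] fractionalD(3)[OF Jf(1)]])
  finally show ?thesis by (simp add: mult_Inv)
qed

text \<open>Fix a nonzero \<open>i \<in> I\<close> and a common denominator \<open>d\<close> of
  \<open>I\<close>. Where \<open>d \<otimes> i\<close> is a unit, \<open>i\<close> is a local
  generator; finite character bounds the remaining places. This yields finite support in the direct
  sum.\<close>

lemma finite_nonprincipal: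
  assumes I: "I \<in> carrier G"
  shows "finite {M \<in> Max_spec K R. v_op K (localization K R M) I \<notin> Prin K (localization K R M)}"
proof -
  have If: "I \<in> fractional_ideals K R" "star (I \<cdot>\<^bsub>K\<^esub> colon K R I) = R" using I by (auto simp: mem_Inv)
  note Ic = fractionalD(3)[OF If(1)]
  obtain i where i: "i \<in> I" "i \<noteq> \<zero>" by (rule Inv_nonzero[OF If])
  obtain d where d: "d \<in> R" "d \<noteq> \<zero>" "\<forall>i\<in>I. d \<otimes> i \<in> R" using fractionalD(2)[OF If(1)] by blast
  have "d \<otimes> i \<in> R - {\<zero>}" using d i Ic by (auto simp: integral_iff subsetD)
  then have "finite {M \<in> Max_spec K R. d \<otimes> i \<in> M}" using lf unfolding locally_finite_def by blast
  moreover have "v_op K (localization K R M) I \<in> Prin K (localization K R M)" if "M \<in> Max_spec K R" "d \<otimes> i \<notin> M" for M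
    using v_op_principal[OF that(1) Ic i(1)] d that by auto
  ultimately show ?thesis by (rule_tac finite_subset[rotated]) auto
qed

text \<open>A priori only the multiples of \<open>x\<close> by elements of \<open>M\<close> lie in
  \<open>I\<close> locally, by \<open>v_op_near\<close>. Here \<open>star M = R\<close> enters: it
  upgrades \<open>z M \<subseteq> I\<close>, for a multiple \<open>z\<close> of \<open>x\<close> by
  a unit at \<open>M\<close>, to \<open>z \<in> I\<close>.\<close>

lemma principal_generator_mem:
  assumes I: "I \<in> carrier G" and M: "M \<in> \<Delta>"
    and x: "x \<in> carrier K" "v_op K (localization K R M) I = x <#\<^bsub>K\<^esub> localization K R M"
  obtains s where "s \<in> R - M" "s \<otimes> x \<in> I"
proof -
  have If: "I \<in> fractional_ideals K R" "star (I \<cdot>\<^bsub>K\<^esub> colon K R I) = R" "star I = I" using I by (auto simp: mem_Inv)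
  note Ic = fractionalD(3)[OF If(1)]
  have M': "M \<in> Max_spec K R" using M by auto
  interpret V: qdomain K "localization K R M" by (rule qdomain_loc[OF M'])
  have xv: "x \<in> v_op K (localization K R M) I" unfolding x(2) using x(1) by (auto simp: mem_l_coset intro!: bexI[of _ \<one>])
  obtain e where e: "e \<in> M" "e \<noteq> \<zero>" by (rule Delta_nonzero[OF M])
  obtain w where w: "w \<in> carrier K" "w \<otimes> e \<in> R" "w \<notin> localization K R M"
    "\<And>N. N \<in> Max_spec K R \<Longrightarrow> N \<noteq> M \<Longrightarrow> w \<in> localization K R N" using pole_only_at[OF M' e] by blast
  \<comment> \<open>Since \<open>n \<in> M\<close>, a multiple of \<open>x \<otimes> n\<close> lies
    in \<open>I\<close>; since \<open>n \<otimes> w\<close> is a unit at \<open>M\<close>, a further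
    factor \<open>w\<close> turns it into a unit multiple of \<open>x\<close>.\<close>
  obtain n where n: "n \<in> M" "n \<otimes> w \<in> R - M" by (rule valuation[OF M' w(1,3)])
  obtain s where s: "s \<in> R - M" "s \<otimes> (x \<otimes> n) \<in> I" by (rule v_op_near[OF M' fractionalD(1)[OF If(1)] xv n(1)])
  have nc: "n \<in> carrier K" by (rule Max_carr[OF M' n(1)])
  have sn: "s \<otimes> (n \<otimes> w) \<in> R - M" by (rule Max_compl_mult[OF M' s(1) n(2)])
  let ?i = "s \<otimes> (x \<otimes> n)"
  let ?z = "s \<otimes> (n \<otimes> w) \<otimes> x"
  have zi: "?z = ?i \<otimes> w" and zc: "?z \<in> carrier K" and ic: "?i \<in> carrier K"
    using s nc w x by (auto simp: m_ac)
  \<comment> \<open>At \<open>M\<close> the element \<open>x \<otimes> m\<close> lies in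
    \<open>I\<close> locally; at any other \<open>N\<close>, \<open>?z\<close> is an element of
    \<open>I\<close> times \<open>w\<close>, which has no pole there.\<close>
  have z_mem: "?z \<otimes> m \<in> I" if m: "m \<in> M" for m
  proof (rule local_global[OF fractionalD(1)[OF If(1)]])
    have mc: "m \<in> carrier K" and mR: "m \<in> R" using m Max_carr[OF M'] Max_R[OF M'] by auto
    show "?z \<otimes> m \<in> carrier K" using zc mc by simp
    fix N assume N: "N \<in> Max_spec K R"
    show "\<exists>t\<in>R - N. t \<otimes> (?z \<otimes> m) \<in> I"
    proof (cases "N = M")
      case True
      obtain t where t: "t \<in> R - M" "t \<otimes> (x \<otimes> m) \<in> I" by (rule v_op_near[OF M' fractionalD(1)[OF If(1)] xv m])
      have tc: "t \<in> carrier K" and sc: "s \<in> carrier K" using t s by auto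
      have "t \<otimes> (?z \<otimes> m) = s \<otimes> (n \<otimes> w) \<otimes> (t \<otimes> (x \<otimes> m))" using tc mc x(1) sc nc w(1) by (simp add: m_ac)
      then have "t \<otimes> (?z \<otimes> m) \<in> I" using fractionalD(6)[OF If(1) _ t(2)] sn by auto
      then show ?thesis using t True by blast
    next
      case False
      obtain t where t: "t \<in> R - N" "t \<otimes> w \<in> R" using w(4)[OF N False] mem_loc[OF N] by blast
      have "t \<otimes> (?z \<otimes> m) = m \<otimes> (t \<otimes> w) \<otimes> ?i" unfolding zi using t ic mc w(1) by (simp add: m_ac)
      moreover have "m \<otimes> (t \<otimes> w) \<in> R" using mR t by simp
      ultimately have "t \<otimes> (?z \<otimes> m) \<in> I" using fractionalD(6)[OF If(1) _ s(2)] by simp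
      then show ?thesis using t by blast
    qed
  qed
  have "?z \<otimes> \<one> \<in> I" by (rule star_mult[OF Max_frac[OF M'] If(1,3) zc z_mem]) (simp_all only: star_Max[OF M] R_one)
  then show ?thesis using that[OF sn] zc by simp
qed

end

section \<open>Kernel and image of the localization map\<close>

text \<open>The third isomorphism theorem in the shape of the local class group. The map
  \<open>h\<close> factors through \<open>G Mod N\<close>, and the kernel of the induced map is the
  given set of cosets.\<close>

lemma factor_factor_iso:
  assumes G: "comm_group G" and S: "group S" and h: "h \<in> hom G S" and surj: "h ` carrier G = carrier S"
    and N: "subgroup N G" "N \<subseteq> kernel G S h"
  shows "(G Mod N) Mod {N #>\<^bsub>G\<^esub> x | x. x \<in> kernel G S h} \<cong> S"
proof -
  interpret G: comm_group G by fact
  interpret h: group_hom G S h using S h by (intro group_hom.intro group_hom_axioms.intro) (simp_all add: G.group_axioms)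
  have norm: "N \<lhd> G" by (rule G.subgroup_imp_normal[OF N(1)])
  obtain g where g: "g \<in> hom (G Mod N) S" "\<And>x. x \<in> carrier G \<Longrightarrow> g (N #>\<^bsub>G\<^esub> x) = h x"
    using h.FactGroup_universal_kernel[OF norm N(2)] by blast
  interpret g: group_hom "G Mod N" S g
    using S g(1) normal.factorgroup_is_group[OF norm] by (intro group_hom.intro group_hom_axioms.intro)
  have carr: "carrier (G Mod N) = {N #>\<^bsub>G\<^esub> x | x. x \<in> carrier G}"
    by (auto simp: FactGroup_def RCOSETS_def)
  have "kernel (G Mod N) S g = {N #>\<^bsub>G\<^esub> x | x. x \<in> kernel G S h}"
    unfolding kernel_def carr using g(2) by auto
  moreover have "g ` carrier (G Mod N) = carrier S"
  proof -
    have "g ` carrier (G Mod N) = (\<lambda>x. g (N #>\<^bsub>G\<^esub> x)) ` carrier G" unfolding carr by auto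
    also have "\<dots> = h ` carrier G" using g(2) by (rule image_cong[OF refl])
    finally show ?thesis using surj by simp
  qed
  ultimately show ?thesis using g.FactGroup_iso by simp
qed

section \<open>Kernel: local principality and invertibility\<close>

context lf_prufer_star
begin

lemma mem_Inv_d_op: "I \<in> carrier (Inv_star K R d_op) \<longleftrightarrow> I \<in> fractional_ideals K R \<and> I \<cdot>\<^bsub>K\<^esub> colon K R I = R"
  by (auto simp: Inv_star_def star_invertible_def d_op_def)

text \<open>With \<open>\<one>\<close> in \<open>I (R : I)\<close> itself, each
  \<open>x \<in> star I\<close> is a sum of terms \<open>(d x) i\<close>, where
  \<open>d x \<in> R\<close> because \<open>star I\<close> and \<open>I\<close> have the same colon.
  So \<open>I\<close> is star-closed.\<close>

lemma Inv_d_op_subset: "carrier (Inv_star K R d_op) \<subseteq> carrier G"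
proof
  fix I assume "I \<in> carrier (Inv_star K R d_op)"
  then have I: "I \<in> fractional_ideals K R" "I \<cdot>\<^bsub>K\<^esub> colon K R I = R" by (auto simp: mem_Inv_d_op)
  note Ic = fractionalD(3)[OF I(1)]
  have "x \<in> I" if x: "x \<in> star I" for x
  proof -
    have xc: "x \<in> carrier K" using x fractionalD(3)[OF star_frac[OF I(1)]] by auto
    have one: "\<one> \<in> I \<cdot>\<^bsub>K\<^esub> colon K R I" using I(2) by simp
    have "x \<otimes> \<one> \<in> I"
    proof (rule prod_mult_mem[OF one Ic _ xc fractionalD(5)[OF I(1)]])
      fix i d assume i: "i \<in> I" and d: "d \<in> colon K R I"
      have "d \<in> colon K R (star I)" using d colon_star[OF I(1)] by simp
      then have "d \<otimes> x \<in> R" "d \<in> carrier K" using x by (auto simp: mem_colon)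
      moreover have "x \<otimes> (i \<otimes> d) = d \<otimes> x \<otimes> i" using xc \<open>d \<in> carrier K\<close> subsetD[OF Ic i] by (simp add: m_ac)
      ultimately show "x \<otimes> (i \<otimes> d) \<in> I" using fractionalD(6)[OF I(1)] i by simp
    qed (auto simp: mem_colon)
    then show ?thesis using xc by simp
  qed
  then show "I \<in> carrier G" using I star_incl[OF I(1)] star_R by (auto simp: mem_Inv)
qed

text \<open>Up to factors outside \<open>M\<close>, the local generators of \<open>I\<close> and
  \<open>(R : I)\<close> lie in the ideals themselves, and their product is a unit at
  \<open>M\<close>.\<close>

lemma colon_principal:
  assumes I: "I \<in> carrier G" and M: "M \<in> \<Delta>"
    and pr: "v_op K (localization K R M) I \<in> Prin K (localization K R M)"
  shows "\<exists>s\<in>R - M. s \<in> I \<cdot>\<^bsub>K\<^esub> colon K R I"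
proof -
  let ?V = "localization K R M"
  have M': "M \<in> Max_spec K R" using M by auto
  interpret V: star_domain K ?V "v_op K ?V" by (rule star_domain_loc[OF M])
  interpret VG: comm_group V.G by (rule V.comm_group_Inv)
  have If: "I \<in> fractional_ideals K R" "star (I \<cdot>\<^bsub>K\<^esub> colon K R I) = R" using I by (auto simp: mem_Inv)
  note D = Inv_colon[OF I]
  have ID: "I \<otimes>\<^bsub>G\<^esub> colon K R I = R" using If(2) by (simp add: mult_Inv)
  have "v_op K ?V R = ?V"
  proof -
    have "colon K ?V R = ?V"
    proof
      show "colon K ?V R \<subseteq> ?V" using R_one r_one unfolding mem_colon subset_iff by metis
      show "?V \<subseteq> colon K ?V R" using R_loc[OF M'] by (auto simp: mem_colon)
    qed
    then show ?thesis by (simp add: v_op_def V.colon_R)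
  qed
  then have prod1: "v_op K ?V I \<otimes>\<^bsub>V.G\<^esub> v_op K ?V (colon K R I) = \<one>\<^bsub>V.G\<^esub>"
    using v_op_loc_mult[OF I D M'] ID by (simp add: V.mult_Inv V.one_Inv)
  \<comment> \<open>The local v-closures of \<open>I\<close> and \<open>(R : I)\<close> are inverse
    to each other, so both are principal once one is.\<close>
  have "v_op K ?V (colon K R I) = inv\<^bsub>V.G\<^esub> (v_op K ?V I)"
    using VG.inv_equality[OF _ v_op_loc_Inv[OF I M'] v_op_loc_Inv[OF D M']] prod1
      VG.m_comm[OF v_op_loc_Inv[OF I M'] v_op_loc_Inv[OF D M']] by simp
  then have "v_op K ?V (colon K R I) \<in> Prin K ?V" using subgroup.m_inv_closed[OF V.subgroup_Prin pr] by simp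
  then obtain y where y: "v_op K ?V (colon K R I) = y <#\<^bsub>K\<^esub> ?V" "y \<in> carrier K" "y \<noteq> \<zero>" by (auto simp: Prin_def)
  obtain x where x: "v_op K ?V I = x <#\<^bsub>K\<^esub> ?V" "x \<in> carrier K" "x \<noteq> \<zero>" using pr by (auto simp: Prin_def)
  obtain s where s: "s \<in> R - M" "s \<otimes> x \<in> I" by (rule principal_generator_mem[OF I M x(2,1)])
  obtain t where t: "t \<in> R - M" "t \<otimes> y \<in> colon K R I" by (rule principal_generator_mem[OF D M y(2,1)])
  have Vc: "?V \<subseteq> carrier K" using loc_carr[OF M'] by auto
  have "(x \<otimes> y) <#\<^bsub>K\<^esub> ?V = ?V"
    using prod1 V.coset_mult_Inv[OF x(2) V.coset_R_Inv[OF y(2,3)]] coset_coset[OF Vc x(2) y(2)]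
    by (simp add: x(1) y(1) V.one_Inv)
  then obtain v where v: "v \<in> ?V" "\<one> = x \<otimes> y \<otimes> v" using V.R_one by (auto simp: mem_l_coset set_eq_iff)
  have p: "s \<otimes> x \<otimes> (t \<otimes> y) \<in> I \<cdot>\<^bsub>K\<^esub> colon K R I" by (rule ideal_prod.prod[OF s(2) t(2)])
  have pR: "s \<otimes> x \<otimes> (t \<otimes> y) \<in> R" using p prod_colon_subset[OF fractionalD(3)[OF If(1)]] by blast
  have "s \<otimes> x \<otimes> (t \<otimes> y) \<notin> M"
  proof
    assume m: "s \<otimes> x \<otimes> (t \<otimes> y) \<in> M"
    have "s \<otimes> x \<otimes> (t \<otimes> y) \<otimes> v = s \<otimes> t \<otimes> (x \<otimes> y \<otimes> v)" using s t x(2) y(2) V.R_carr[OF v(1)] by (simp add: m_ac)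
    also have "\<dots> = s \<otimes> t" using v(2)[symmetric] s t by simp
    finally show False using max_not_unit[OF M' v(1) m Max_compl_mult[OF M' s(1) t(1)]] by simp
  qed
  then show ?thesis using p pR by blast
qed

lemma mem_Inv_d_op_iff:
  assumes I: "I \<in> carrier G"
  shows "(\<forall>M\<in>\<Delta>. v_op K (localization K R M) I \<in> Prin K (localization K R M)) \<longleftrightarrow> I \<in> carrier (Inv_star K R d_op)"
proof
  have If: "I \<in> fractional_ideals K R" "star (I \<cdot>\<^bsub>K\<^esub> colon K R I) = R" using I by (auto simp: mem_Inv)
  note Ic = fractionalD(3)[OF If(1)]
  note A = fractional_prod[OF If(1) colon_frac[OF If]] and AR = prod_colon_subset[OF Ic]
  {
    assume pr: "\<forall>M\<in>\<Delta>. v_op K (localization K R M) I \<in> Prin K (localization K R M)"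
    have "\<one> \<in> I \<cdot>\<^bsub>K\<^esub> colon K R I"
    proof (rule ccontr)
      assume "\<one> \<notin> I \<cdot>\<^bsub>K\<^esub> colon K R I"
      then obtain M where M: "M \<in> Max_spec K R" "I \<cdot>\<^bsub>K\<^esub> colon K R I \<subseteq> M" using ex_Max[OF fractionalD(1)[OF A] AR] by blast
      \<comment> \<open>By star-invertibility the closure of such an \<open>M\<close> contains
        \<open>R\<close>, so \<open>M\<close> belongs to \<open>\<Delta>\<close> and the local
        hypothesis applies to it.\<close>
      have "R \<subseteq> star M" using star_mono[OF A Max_frac[OF M(1)] M(2)] If(2) by simp
      then have "M \<in> \<Delta>" using M(1) MaxD(3)[OF M(1)] by auto
      then show False using colon_principal[OF I _ bspec[OF pr]] M(2) by blast
    qed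
    then have "R \<subseteq> I \<cdot>\<^bsub>K\<^esub> colon K R I" using fractionalD(6)[OF A, of _ \<one>] by auto
    then show "I \<in> carrier (Inv_star K R d_op)" using AR If by (auto simp: mem_Inv_d_op)
  }
  assume "I \<in> carrier (Inv_star K R d_op)"
  then have A1: "I \<cdot>\<^bsub>K\<^esub> colon K R I = R" by (simp add: mem_Inv_d_op)
  show "\<forall>M\<in>\<Delta>. v_op K (localization K R M) I \<in> Prin K (localization K R M)"
  proof
    fix M assume "M \<in> \<Delta>"
    then have M: "M \<in> Max_spec K R" by auto
    \<comment> \<open>The product \<open>I (R : I)\<close> is not contained in \<open>M\<close>, so
      a single term \<open>i \<otimes> d\<close> escapes it; then \<open>i\<close> is a local
      generator.\<close>
    have "\<exists>i\<in>I. \<exists>d\<in>colon K R I. i \<otimes> d \<notin> M"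
    proof (rule ccontr)
      assume no: "\<not> (\<exists>i\<in>I. \<exists>d\<in>colon K R I. i \<otimes> d \<notin> M)"
      have "I \<cdot>\<^bsub>K\<^esub> colon K R I \<subseteq> M"
        by (rule subsetI, erule prod_mem) (use no submoduleD(3)[OF MaxD(1)[OF M]] in auto)
      then show False using A1 MaxD(3)[OF M] by auto
    qed
    then obtain i d where id: "i \<in> I" "d \<in> colon K R I" "i \<otimes> d \<notin> M" by blast
    have "d \<in> carrier K" "\<And>j. j \<in> I \<Longrightarrow> d \<otimes> j \<in> R" using id(2) by (auto simp: mem_colon)
    then show "v_op K (localization K R M) I \<in> Prin K (localization K R M)"
      using v_op_principal[OF M Ic id(1)] id(3) m_comm[of i d] subsetD[OF Ic id(1)] by simp
  qed
qed

section \<open>Image: ideals with one prescribed local component\<close>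

lemma normalize_local:
  assumes M: "M \<in> \<Delta>" and L: "L \<in> carrier (Inv_star K (localization K R M) (v_op K (localization K R M)))"
    and w: "w \<in> carrier K" "w \<notin> localization K R M"
  obtains c where "c \<in> carrier K" "c \<noteq> \<zero>" "\<one> \<in> c <#\<^bsub>K\<^esub> L" "c <#\<^bsub>K\<^esub> L \<subseteq> w <#\<^bsub>K\<^esub> localization K R M"
proof -
  let ?V = "localization K R M"
  have M': "M \<in> Max_spec K R" using M by auto
  interpret V: star_domain K ?V "v_op K ?V" by (rule star_domain_loc[OF M])
  have Lf: "L \<in> fractional_ideals K ?V" "v_op K ?V (L \<cdot>\<^bsub>K\<^esub> colon K ?V L) = ?V" using L by (auto simp: V.mem_Inv)
  have Lc: "L \<subseteq> carrier K" by (rule V.fractionalD(3)[OF Lf(1)])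
  note D = V.colon_frac[OF Lf] and A = V.fractional_prod[OF Lf(1) V.colon_frac[OF Lf]]
  obtain n where n: "n \<in> M" "n \<otimes> w \<in> R - M" by (rule valuation[OF M' w])
  have nc: "n \<in> carrier K" by (rule Max_carr[OF M' n(1)])
  \<comment> \<open>The product of \<open>L\<close> and its colon has v-closure \<open>?V\<close>,
    so it contains \<open>n\<close> up to a factor outside \<open>M\<close>.\<close>
  have "\<one> \<in> v_op K ?V (L \<cdot>\<^bsub>K\<^esub> colon K ?V L)" using Lf(2) V.R_one by simp
  then obtain s where s: "s \<in> R - M" "s \<otimes> (\<one> \<otimes> n) \<in> L \<cdot>\<^bsub>K\<^esub> colon K ?V L"
    by (rule v_op_near[OF M' loc_submodule_R[OF M' V.fractionalD(1)[OF A]] _ n(1)])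
  \<comment> \<open>\<open>?m\<close> is the maximal ideal of the localization.\<close>
  let ?m = "{x \<in> carrier K. \<exists>t\<in>R - M. t \<otimes> x \<in> M}"
  note Mm = submoduleD[OF MaxD(1)[OF M']]
  have m_add: "x \<oplus> y \<in> ?m" if xy: "x \<in> ?m" "y \<in> ?m" for x y
  proof -
    obtain t u where t: "t \<in> R - M" "t \<otimes> x \<in> M" and u: "u \<in> R - M" "u \<otimes> y \<in> M" using xy by blast
    have c: "x \<in> carrier K" "y \<in> carrier K" "t \<in> R" "u \<in> R" using xy t u by auto
    have "t \<otimes> u \<otimes> (x \<oplus> y) = u \<otimes> (t \<otimes> x) \<oplus> t \<otimes> (u \<otimes> y)" using c R_carr by (simp add: m_ac r_distr)
    also have "\<dots> \<in> M" using Mm(3) Mm(4) c t u by simp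
    finally show ?thesis using Max_compl_mult[OF M' t(1) u(1)] c by auto
  qed
  \<comment> \<open>Since \<open>n \<otimes> w\<close> is a unit at \<open>M\<close>, the products
    \<open>w \<otimes> (l \<otimes> d)\<close> cannot all lie in \<open>?m\<close>.\<close>
  have "\<exists>l\<in>L. \<exists>d\<in>colon K ?V L. w \<otimes> (l \<otimes> d) \<notin> ?m"
  proof (rule ccontr)
    assume no: "\<not> (\<exists>l\<in>L. \<exists>d\<in>colon K ?V L. w \<otimes> (l \<otimes> d) \<notin> ?m)"
    have "w \<otimes> (s \<otimes> (\<one> \<otimes> n)) \<in> ?m"
      by (rule prod_mult_mem[OF s(2) Lc V.fractionalD(3)[OF D] w(1) m_add]) (use no in auto)
    then obtain t where t: "t \<in> R - M" "t \<otimes> (w \<otimes> (s \<otimes> (\<one> \<otimes> n))) \<in> M" by blast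
    have c: "t \<in> carrier K" "s \<in> carrier K" using t s by auto
    have "t \<otimes> (w \<otimes> (s \<otimes> (\<one> \<otimes> n))) = t \<otimes> s \<otimes> (n \<otimes> w)" using c w nc by (simp add: m_ac)
    then show False using t(2) Max_compl_mult[OF M' Max_compl_mult[OF M' t(1) s(1)] n(2)] by simp
  qed
  then obtain l d where ld: "l \<in> L" "d \<in> colon K ?V L" "w \<otimes> (l \<otimes> d) \<notin> ?m" by blast
  have lc: "l \<in> carrier K" and dc: "d \<in> carrier K" using ld Lc by (auto simp: mem_colon)
  let ?y = "w \<otimes> (l \<otimes> d)"
  have yc: "?y \<in> carrier K" using w lc dc by simp
  have y0: "?y \<noteq> \<zero>" using ld(3) Max_one[OF M'] Max_zero[OF M'] by auto
  have iy: "inv ?y \<in> ?V"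
  proof (rule ccontr)
    assume "inv ?y \<notin> ?V"
    then obtain p where p: "p \<in> M" "p \<otimes> inv ?y \<in> R - M" using valuation[OF M' inv_nz(1)[OF yc y0]] by blast
    have "p \<otimes> inv ?y \<otimes> ?y = p" using Max_carr[OF M' p(1)] yc y0 inv_nz[OF yc y0] by (simp only: m_assoc r_one)
    then have "?y \<in> ?m" using p yc by (intro CollectI conjI bexI[of _ "p \<otimes> inv ?y"]) simp_all
    then show False using ld(3) by simp
  qed
  \<comment> \<open>Dividing by \<open>?y\<close> makes \<open>w \<otimes> ?e\<close> send
    \<open>l\<close> to \<open>\<one>\<close>. As \<open>d\<close> multiplies \<open>L\<close> into
    \<open>?V\<close> and \<open>inv ?y \<in> ?V\<close>, the scaled module stays inside
    \<open>w\<close> times \<open>?V\<close>.\<close>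
  let ?e = "inv ?y \<otimes> d"
  have ic: "inv ?y \<in> carrier K" by (rule inv_nz(1)[OF yc y0])
  have ec: "?e \<in> carrier K" using ic dc by simp
  have one: "w \<otimes> ?e \<otimes> l = \<one>"
  proof -
    have "w \<otimes> ?e \<otimes> l = inv ?y \<otimes> ?y" using ic w(1) dc lc m_ac by (metis m_closed)
    then show ?thesis using inv_nz(3)[OF yc y0] by simp
  qed
  show ?thesis
  proof (rule that[of "w \<otimes> ?e"])
    show "w \<otimes> ?e \<in> carrier K" using w ec by simp
    show "w \<otimes> ?e \<noteq> \<zero>" using one lc by auto
    show "\<one> \<in> w \<otimes> ?e <#\<^bsub>K\<^esub> L" using one[symmetric] ld(1) by (auto simp: mem_l_coset)
    show "w \<otimes> ?e <#\<^bsub>K\<^esub> L \<subseteq> w <#\<^bsub>K\<^esub> ?V"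
    proof
      fix x assume "x \<in> w \<otimes> ?e <#\<^bsub>K\<^esub> L"
      then obtain a where a: "a \<in> L" "x = w \<otimes> ?e \<otimes> a" by (auto simp: mem_l_coset)
      have "d \<otimes> a \<in> ?V" using ld(2) a by (auto simp: mem_colon)
      then have "inv ?y \<otimes> (d \<otimes> a) \<in> ?V" using iy by simp
      moreover have "x = w \<otimes> (inv ?y \<otimes> (d \<otimes> a))" unfolding a(2) using w(1) ic dc subsetD[OF Lc a(1)] by (simp only: m_assoc m_closed)
      ultimately show "x \<in> w <#\<^bsub>K\<^esub> ?V" by (auto simp: mem_l_coset)
    qed
  qed
qed

text \<open>An ideal is built that agrees with a scaled \<open>L\<close> at \<open>M\<close> and is
  trivial at all other maximal ideals. Its star closure is the required group element, and closing
  leaves the local v-closures unchanged.\<close>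

lemma single_surj:
  assumes M: "M \<in> \<Delta>" and L: "L \<in> carrier (Inv_star K (localization K R M) (v_op K (localization K R M)))"
  obtains I c where "I \<in> carrier G" "c \<in> carrier K" "c \<noteq> \<zero>" "v_op K (localization K R M) I = c <#\<^bsub>K\<^esub> L"
    "\<And>N. N \<in> Max_spec K R \<Longrightarrow> N \<noteq> M \<Longrightarrow> v_op K (localization K R N) I \<in> Prin K (localization K R N)"
proof -
  let ?V = "localization K R M"
  have M': "M \<in> Max_spec K R" using M by auto
  interpret V: star_domain K ?V "v_op K ?V" by (rule star_domain_loc[OF M])
  have Lf: "L \<in> fractional_ideals K ?V" "v_op K ?V (L \<cdot>\<^bsub>K\<^esub> colon K ?V L) = ?V" "v_op K ?V L = L"
    using L by (auto simp: V.mem_Inv)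
  have Lc: "L \<subseteq> carrier K" by (rule V.fractionalD(3)[OF Lf(1)])
  obtain e where e: "e \<in> M" "e \<noteq> \<zero>" by (rule Delta_nonzero[OF M])
  obtain w where w: "w \<in> carrier K" "w \<otimes> e \<in> R" "w \<notin> ?V"
    "\<And>N. N \<in> Max_spec K R \<Longrightarrow> N \<noteq> M \<Longrightarrow> w \<in> localization K R N" using pole_only_at[OF M' e] by blast
  obtain c where c: "c \<in> carrier K" "c \<noteq> \<zero>" "\<one> \<in> c <#\<^bsub>K\<^esub> L" "c <#\<^bsub>K\<^esub> L \<subseteq> w <#\<^bsub>K\<^esub> ?V"
    by (rule normalize_local[OF M L w(1,3)])
  define P where "P = c <#\<^bsub>K\<^esub> L"
  have P1: "\<one> \<in> P" and Pw: "P \<subseteq> w <#\<^bsub>K\<^esub> ?V" using c by (auto simp: P_def)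
  have Pm: "subalgebra ?V P K" unfolding P_def by (rule V.submodule_coset[OF V.fractionalD(1)[OF Lf(1)] c(1)])
  note Pm' = submoduleD[OF loc_submodule_R[OF M' Pm]]
  have vP: "v_op K ?V P = P" unfolding P_def using V.v_op_coset[OF Lc c(1,2)] Lf(3) by simp
  \<comment> \<open>The elements of the scaled module without poles away from \<open>M\<close>;
    \<open>\<one>\<close> is one of them.\<close>
  define I where "I = {y \<in> P. \<forall>N\<in>Max_spec K R. N \<noteq> M \<longrightarrow> y \<in> localization K R N}"
  have IN: "y \<in> localization K R N" if "y \<in> I" "N \<in> Max_spec K R" "N \<noteq> M" for y N using that unfolding I_def by blast
  have IP: "I \<subseteq> P" unfolding I_def by blast
  have I_div: "\<exists>v\<in>?V. y = w \<otimes> v" if "y \<in> I" for y using that IP Pw by (auto simp: mem_l_coset)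
  have loc_ring: "qdomain K (localization K R N)" if "N \<in> Max_spec K R" for N by (rule qdomain_loc[OF that])
  have Im: "subalgebra R I K"
  proof (rule submoduleI)
    show "I \<subseteq> carrier K" using IP Pm'(1) by blast
    show "\<zero> \<in> I" unfolding I_def using Pm'(2) R_loc by auto
    show "a \<oplus> b \<in> I" if "a \<in> I" "b \<in> I" for a b
      using that Pm'(3)[of a b] qdomain.R_add[OF loc_ring, of _ a b] unfolding I_def by simp
    show "r \<otimes> a \<in> I" if "r \<in> R" "a \<in> I" for r a
      using that Pm'(4)[of r a] qdomain.R_mult[OF loc_ring, of _ r a] R_loc[of _ r] unfolding I_def by simp
  qed
  have Ic: "I \<subseteq> carrier K" by (rule submoduleD(1)[OF Im])
  have I1: "\<one> \<in> I" unfolding I_def using P1 R_loc by auto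
  have in_R: "d \<otimes> y \<in> R" if d: "d \<in> carrier K" "d \<otimes> y \<in> ?V" and y: "y \<in> I"
    and dN: "\<And>N. N \<in> Max_spec K R \<Longrightarrow> N \<noteq> M \<Longrightarrow> d \<otimes> y \<in> localization K R N" for d y
  proof (rule local_global[OF submodule_R])
    show "d \<otimes> y \<in> carrier K" using d y Ic by auto
    fix N assume N: "N \<in> Max_spec K R"
    have "d \<otimes> y \<in> localization K R N" using d(2) dN[OF N] by (cases "N = M") auto
    then show "\<exists>s\<in>R - N. s \<otimes> (d \<otimes> y) \<in> R" using mem_loc[OF N] by blast
  qed
  have in_R': "d \<otimes> y \<in> R" if d: "d \<in> R" "d \<otimes> y \<in> ?V" and y: "y \<in> I" for d y
    by (rule in_R[OF _ d(2) y]) (use d IN[OF y] R_loc qdomain.R_mult[OF loc_ring] in auto)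
  have eR: "e \<in> R" "e \<in> carrier K" using e Max_R[OF M'] Max_carr[OF M'] by auto
  \<comment> \<open>\<open>e\<close> is a common denominator because
    \<open>w \<otimes> e \<in> R\<close> and every element of \<open>I\<close> is \<open>w\<close>
    times an element of \<open>?V\<close>.\<close>
  have If: "I \<in> fractional_ideals K R"
  proof (rule fractionalI[OF Im eR(1) e(2)])
    fix y assume y: "y \<in> I"
    then obtain v where v: "v \<in> ?V" "y = w \<otimes> v" using I_div by blast
    have "w \<otimes> e \<otimes> v \<in> ?V" using v R_loc[OF M' w(2)] by simp
    moreover have "e \<otimes> y = w \<otimes> e \<otimes> v" unfolding v(2) using eR w(1) V.R_carr[OF v(1)] by (simp add: m_ac)
    ultimately show "e \<otimes> y \<in> R" using in_R'[OF eR(1) _ y] by simp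
  qed
  \<comment> \<open>Writing \<open>a = w \<otimes> v\<close>, it is enough to clear the denominator
    of \<open>v\<close>, as \<open>w\<close> has no pole away from \<open>M\<close>. Thus
    \<open>I\<close> fills out \<open>P\<close> at \<open>M\<close>.\<close>
  have near: "\<exists>s\<in>R - M. s \<otimes> a \<in> I" if a: "a \<in> P" for a
  proof -
    obtain v where v: "v \<in> ?V" "a = w \<otimes> v" using subsetD[OF Pw a] by (auto simp: mem_l_coset)
    obtain s where s: "s \<in> R - M" "s \<otimes> v \<in> R" using v mem_loc[OF M'] by blast
    have eq: "s \<otimes> a = w \<otimes> (s \<otimes> v)" unfolding v(2) using s w(1) V.R_carr[OF v(1)] by (simp add: m_lcomm)
    have "s \<otimes> a \<in> P" using Pm'(4) s a by auto
    moreover have "s \<otimes> a \<in> localization K R N" if "N \<in> Max_spec K R" "N \<noteq> M" for N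
      unfolding eq using w(4)[OF that] R_loc[OF that(1) s(2)] qdomain.R_mult[OF loc_ring[OF that(1)]] by blast
    ultimately have "s \<otimes> a \<in> I" unfolding I_def by blast
    then show ?thesis using s by blast
  qed
  have "colon K ?V I = colon K ?V P"
  proof
    show "colon K ?V P \<subseteq> colon K ?V I" using IP by (auto simp only: mem_colon subset_iff)
    have "y \<otimes> a \<in> ?V" if y: "y \<in> colon K ?V I" and a: "a \<in> P" for y a
    proof -
      obtain s where s: "s \<in> R - M" "s \<otimes> a \<in> I" using near[OF a] by blast
      have yc: "y \<in> carrier K" and ac: "a \<in> carrier K" using y a Pm'(1) by (auto simp: mem_colon)
      have "y \<otimes> (s \<otimes> a) \<in> ?V" using y s by (simp add: mem_colon)
      then have "s \<otimes> (y \<otimes> a) \<in> ?V" using yc ac s m_lcomm[of s y a] by simp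
      then show ?thesis using loc_cancel[OF M' s(1)] yc ac by simp
    qed
    then show "colon K ?V I \<subseteq> colon K ?V P" by (auto simp: mem_colon)
  qed
  then have vI: "v_op K ?V I = c <#\<^bsub>K\<^esub> L" using V.v_op_cong vP unfolding P_def by blast
  have vN: "v_op K (localization K R N) I \<in> Prin K (localization K R N)" if N: "N \<in> Max_spec K R" "N \<noteq> M" for N
  proof -
    interpret N: qdomain K "localization K R N" by (rule loc_ring[OF N(1)])
    have "colon K (localization K R N) I = localization K R N"
    proof
      show "localization K R N \<subseteq> colon K (localization K R N) I" using IN[OF _ N] by (auto simp: mem_colon)
      show "colon K (localization K R N) I \<subseteq> localization K R N" using I1 r_one unfolding mem_colon subset_iff by metis
    qed
    then have "v_op K (localization K R N) I = localization K R N" by (simp add: v_op_def N.colon_R)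
    also have "\<dots> = \<one> <#\<^bsub>K\<^esub> localization K R N" by (rule one_coset[symmetric]) auto
    finally show ?thesis unfolding Prin_def by auto
  qed
  note D = fractional_colon[OF If I1 one_not_zero]
  note A = fractional_prod[OF If D] and AR = prod_colon_subset[OF Ic]
  \<comment> \<open>The inclusion of \<open>M\<close> in \<open>I (R : I)\<close>, combined with
    \<open>star M = R\<close>, makes \<open>I\<close> star-invertible.\<close>
  have "m \<in> I \<cdot>\<^bsub>K\<^esub> colon K R I" if m: "m \<in> M" for m
  proof (rule local_global[OF fractionalD(1)[OF A] Max_carr[OF M' m]])
    fix N assume N: "N \<in> Max_spec K R"
    show "\<exists>s\<in>R - N. s \<otimes> m \<in> I \<cdot>\<^bsub>K\<^esub> colon K R I"
    proof (cases "N = M")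
      case True
      \<comment> \<open>By \<open>v_op_near\<close> it suffices that \<open>\<one>\<close> lies in
        the local v-closure of the product. Any \<open>y\<close> multiplying
        \<open>I (R : I)\<close> into \<open>?V\<close> does the same for \<open>L\<close> and its
        colon, and \<open>L\<close> is v-invertible.\<close>
      have "\<one> \<in> v_op K ?V (I \<cdot>\<^bsub>K\<^esub> colon K R I)" unfolding V.mem_v_op
      proof (intro conjI ballI impI)
        fix y assume y: "y \<in> carrier K" "\<forall>p\<in>I \<cdot>\<^bsub>K\<^esub> colon K R I. y \<otimes> p \<in> ?V"
        have LD: "y \<otimes> (l \<otimes> d) \<in> ?V" if l: "l \<in> L" and d: "d \<in> colon K ?V L" for l d
        proof -
          have lc: "l \<in> carrier K" and dc: "d \<in> carrier K" using l d Lc by (auto simp: mem_colon)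
          have icc: "inv c \<in> carrier K" by (rule inv_nz(1)[OF c(1,2)])
          \<comment> \<open>\<open>?b\<close> multiplies \<open>P\<close> into \<open>?V\<close>,
            hence lies in \<open>?V\<close> as \<open>\<one> \<in> P\<close>. Its multiple by a
            denominator \<open>t\<close> is in \<open>R\<close> and multiplies \<open>I\<close> into
            \<open>R\<close>.\<close>
          let ?b = "inv c \<otimes> d"
          have bc: "?b \<in> carrier K" using icc dc by simp
          have bP: "?b \<otimes> a \<in> ?V" if a: "a \<in> P" for a
          proof -
            obtain k where k: "k \<in> L" "a = c \<otimes> k" using a unfolding P_def by (auto simp: mem_l_coset)
            have "?b \<otimes> a = (inv c \<otimes> c) \<otimes> (d \<otimes> k)" unfolding k(2) using icc c(1) dc subsetD[OF Lc k(1)] by (simp only: m_ac m_closed)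
            then have "?b \<otimes> a = d \<otimes> k" using c(1,2) dc subsetD[OF Lc k(1)] by simp
            then show ?thesis using d k(1) by (simp add: mem_colon)
          qed
          have "?b \<in> ?V" using bP[OF P1] bc by simp
          then obtain t where t: "t \<in> R - M" "t \<otimes> ?b \<in> R" using mem_loc[OF M'] by blast
          have tb: "t \<otimes> ?b \<in> colon K R I" unfolding mem_colon
          proof (intro conjI ballI)
            show "t \<otimes> ?b \<in> carrier K" using t(2) by simp
            fix x assume x: "x \<in> I"
            have "t \<otimes> (?b \<otimes> x) \<in> ?V" using bP subsetD[OF IP x] R_loc[OF M', of t] t(1) by simp
            then have "t \<otimes> ?b \<otimes> x \<in> ?V" using t(1) bc subsetD[OF Ic x] m_assoc[of t ?b x] by simp
            then show "t \<otimes> ?b \<otimes> x \<in> R" by (rule in_R'[OF t(2) _ x])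
          qed
          have "c \<otimes> l \<in> P" using l unfolding P_def by (auto simp: mem_l_coset)
          then obtain s where s: "s \<in> R - M" "s \<otimes> (c \<otimes> l) \<in> I" using near by blast
          have "y \<otimes> (s \<otimes> (c \<otimes> l) \<otimes> (t \<otimes> ?b)) \<in> ?V" using y(2) ideal_prod.prod[OF s(2) tb] by blast
          moreover have "y \<otimes> (s \<otimes> (c \<otimes> l) \<otimes> (t \<otimes> ?b)) = s \<otimes> t \<otimes> (y \<otimes> (l \<otimes> d))"
          proof -
            have sc: "s \<in> carrier K" "t \<in> carrier K" using s t by auto
            have "y \<otimes> (s \<otimes> (c \<otimes> l) \<otimes> (t \<otimes> ?b)) = (inv c \<otimes> c) \<otimes> (s \<otimes> t \<otimes> (y \<otimes> (l \<otimes> d)))"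
              using sc y(1) icc c(1) lc dc by (simp only: m_ac m_closed)
            then show ?thesis using sc y(1) c(1,2) lc dc by simp
          qed
          ultimately have "s \<otimes> t \<otimes> (y \<otimes> (l \<otimes> d)) \<in> ?V" by simp
          moreover have "y \<otimes> (l \<otimes> d) \<in> carrier K" using y(1) lc dc by simp
          ultimately show ?thesis by (rule_tac loc_cancel[OF M' Max_compl_mult[OF M' s(1) t(1)]])
        qed
        have "\<one> \<in> v_op K ?V (L \<cdot>\<^bsub>K\<^esub> colon K ?V L)" using Lf(2) V.R_one by simp
        then show "\<one> \<otimes> y \<in> ?V"
        proof (rule V.v_op_colonD(1)[OF _ y(1)])
          fix p assume p: "p \<in> L \<cdot>\<^bsub>K\<^esub> colon K ?V L"
          show "y \<otimes> p \<in> ?V" by (rule prod_mult_mem[OF p Lc _ y(1) V.R_add LD]) (auto simp: mem_colon)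
        qed
      qed simp
      then obtain s where "s \<in> R - M" "s \<otimes> (\<one> \<otimes> m) \<in> I \<cdot>\<^bsub>K\<^esub> colon K R I"
        by (rule v_op_near[OF M' fractionalD(1)[OF A] _ m])
      then show ?thesis using True Max_carr[OF M' m] by auto
    next
      case False
      \<comment> \<open>Clearing \<open>w\<close> at \<open>N\<close> clears all of
        \<open>I\<close>; as \<open>\<one> \<in> I\<close>, this puts \<open>d\<close>, an element
        outside \<open>N\<close>, into \<open>I (R : I)\<close>.\<close>
      obtain d where d: "d \<in> R - N" "d \<otimes> w \<in> R" using w(4)[OF N False] mem_loc[OF N] by blast
      have "d \<otimes> y \<in> R" if y: "y \<in> I" for y
      proof -
        obtain v where v: "v \<in> ?V" "y = w \<otimes> v" using I_div[OF y] by blast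
        have "d \<otimes> y = d \<otimes> w \<otimes> v" unfolding v(2) using d w(1) V.R_carr[OF v(1)] by (simp add: m_assoc)
        then have "d \<otimes> y \<in> ?V" using R_loc[OF M' d(2)] v by simp
        then show ?thesis using in_R'[OF _ _ y] d by blast
      qed
      then have "d \<in> colon K R I" using d by (auto simp: mem_colon)
      then have "\<one> \<otimes> d \<in> I \<cdot>\<^bsub>K\<^esub> colon K R I" by (rule ideal_prod.prod[OF I1])
      then have "m \<otimes> d \<in> I \<cdot>\<^bsub>K\<^esub> colon K R I" using fractionalD(6)[OF A Max_R[OF M' m]] d by auto
      then show ?thesis using d(1) m_comm[of m d] Max_carr[OF M' m] by (intro bexI[OF _ d(1)]) auto
    qed
  qed
  then have "star M \<subseteq> star (I \<cdot>\<^bsub>K\<^esub> colon K R I)" by (intro star_mono Max_frac M' A) blast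
  moreover have "star (I \<cdot>\<^bsub>K\<^esub> colon K R I) \<subseteq> R" by (rule star_subset[OF A fractional_R star_R AR])
  ultimately have sI: "star (I \<cdot>\<^bsub>K\<^esub> colon K R I) = R" using star_Max[OF M] by blast
  show ?thesis
  proof (rule that[of "star I" c])
    show "star I \<in> carrier G" using star_Inv_iff[OF If I1] sI by simp
    show "v_op K ?V (star I) = c <#\<^bsub>K\<^esub> L" using v_op_loc_star[OF If sI M'] vI by simp
    show "v_op K (localization K R N) (star I) \<in> Prin K (localization K R N)" if "N \<in> Max_spec K R" "N \<noteq> M" for N
      using v_op_loc_star[OF If sI that(1)] vN[OF that] by simp
  qed (rule c)+
qed

end

section \<open>The class group isomorphism\<close>

context lf_prufer_star
begin

abbreviation "G_loc M \<equiv> Inv_star K (localization K R M) (v_op K (localization K R M))"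
abbreviation "Cl_loc M \<equiv> Cl_star K (localization K R M) (v_op K (localization K R M))"

text \<open>The restriction to \<open>\<Delta>\<close> makes the value extensional, as elements of
  \<open>sum_group\<close> are.\<close>

definition class_map :: "'a set \<Rightarrow> 'a set \<Rightarrow> 'a set set"
  where "class_map I = (\<lambda>M\<in>\<Delta>. Prin K (localization K R M) #>\<^bsub>G_loc M\<^esub> v_op K (localization K R M) I)"

lemma group_Cl_loc: "M \<in> \<Delta> \<Longrightarrow> group (Cl_loc M)"
  using star_domain.group_Cl[OF star_domain_loc] .

lemma one_Cl_loc: "\<one>\<^bsub>Cl_loc M\<^esub> = Prin K (localization K R M)"
  by (simp add: Cl_star_def FactGroup_def)

lemma class_one_iff:
  assumes M: "M \<in> \<Delta>" and L: "L \<in> carrier (G_loc M)"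
  shows "Prin K (localization K R M) #>\<^bsub>G_loc M\<^esub> L = \<one>\<^bsub>Cl_loc M\<^esub> \<longleftrightarrow> L \<in> Prin K (localization K R M)"
proof -
  interpret H: comm_group "G_loc M" by (rule star_domain.comm_group_Inv[OF star_domain_loc[OF M]])
  note sg = star_domain.subgroup_Prin[OF star_domain_loc[OF M]]
  show ?thesis unfolding one_Cl_loc
    using H.coset_join1[OF _ L sg] H.coset_join2[OF L sg] subgroup.subset[OF sg] by blast
qed

lemma class_map_one_iff:
  assumes I: "I \<in> carrier G" and M: "M \<in> \<Delta>"
  shows "class_map I M = \<one>\<^bsub>Cl_loc M\<^esub> \<longleftrightarrow> v_op K (localization K R M) I \<in> Prin K (localization K R M)"
proof -
  have "v_op K (localization K R M) I \<in> carrier (G_loc M)" using v_op_loc_Inv[OF I] M by blast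
  then show ?thesis using class_one_iff[OF M] M by (simp add: class_map_def)
qed

text \<open>Finite support comes from \<open>finite_nonprincipal\<close>, multiplicativity from
  \<open>v_op_loc_mult\<close> read modulo principal ideals.\<close>

lemma class_map_hom: "class_map \<in> hom G (sum_group \<Delta> Cl_loc)"
proof (rule homI)
  fix I assume I: "I \<in> carrier G"
  have "{M \<in> \<Delta>. class_map I M \<noteq> \<one>\<^bsub>Cl_loc M\<^esub>} \<subseteq> {M \<in> Max_spec K R. v_op K (localization K R M) I \<notin> Prin K (localization K R M)}"
    using class_map_one_iff[OF I] by blast
  then have fin: "finite {M \<in> \<Delta>. class_map I M \<noteq> \<one>\<^bsub>Cl_loc M\<^esub>}" by (rule finite_subset[OF _ finite_nonprincipal[OF I]])
  have "class_map I M \<in> carrier (Cl_loc M)" if M: "M \<in> \<Delta>" for M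
    using v_op_loc_Inv[OF I, of M] M by (auto simp: class_map_def Cl_star_def FactGroup_def RCOSETS_def)
  then have "class_map I \<in> (\<Pi>\<^sub>E M\<in>\<Delta>. carrier (Cl_loc M))" unfolding class_map_def by (simp add: PiE_iff)
  then show "class_map I \<in> carrier (sum_group \<Delta> Cl_loc)"
    using fin group_Cl_loc by (subst carrier_sum_group) auto
  fix J assume J: "J \<in> carrier G"
  have "Prin K (localization K R M) #>\<^bsub>G_loc M\<^esub> v_op K (localization K R M) (I \<otimes>\<^bsub>G\<^esub> J) =
     (Prin K (localization K R M) #>\<^bsub>G_loc M\<^esub> v_op K (localization K R M) I) \<otimes>\<^bsub>Cl_loc M\<^esub>
     (Prin K (localization K R M) #>\<^bsub>G_loc M\<^esub> v_op K (localization K R M) J)" if M: "M \<in> \<Delta>" for M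
  proof -
    have M': "M \<in> Max_spec K R" using M by auto
    interpret V: star_domain K "localization K R M" "v_op K (localization K R M)" by (rule star_domain_loc[OF M])
    show ?thesis
      using normal.rcos_sum[OF V.normal_Prin v_op_loc_Inv[OF I M'] v_op_loc_Inv[OF J M']] v_op_loc_mult[OF I J M']
      by (simp add: Cl_star_def FactGroup_def V.mult_Inv)
  qed
  then show "class_map (I \<otimes>\<^bsub>G\<^esub> J) = class_map I \<otimes>\<^bsub>sum_group \<Delta> Cl_loc\<^esub> class_map J"
    by (auto simp: class_map_def fun_eq_iff)
qed

lemma kernel_class_map: "kernel G (sum_group \<Delta> Cl_loc) class_map = carrier (Inv_star K R d_op)"
proof -
  have "class_map I = \<one>\<^bsub>sum_group \<Delta> Cl_loc\<^esub> \<longleftrightarrow> I \<in> carrier (Inv_star K R d_op)" if I: "I \<in> carrier G" for I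
  proof -
    have "class_map I = \<one>\<^bsub>sum_group \<Delta> Cl_loc\<^esub> \<longleftrightarrow> (\<forall>M\<in>\<Delta>. class_map I M = \<one>\<^bsub>Cl_loc M\<^esub>)"
      unfolding one_sum_group class_map_def by (auto simp: fun_eq_iff restrict_def)
    then show ?thesis using class_map_one_iff[OF I] mem_Inv_d_op_iff[OF I] by simp
  qed
  then show ?thesis unfolding kernel_def using Inv_d_op_subset by blast
qed

text \<open>Induction on a finite set containing the support: \<open>single_surj\<close> supplies an
  ideal with the right class at one place and trivial classes elsewhere.\<close>

lemma class_map_surj: "class_map ` carrier G = carrier (sum_group \<Delta> Cl_loc)"
proof -
  let ?S = "sum_group \<Delta> Cl_loc"
  have groupS: "group ?S" using group_Cl_loc by (rule sum_group)
  interpret G: comm_group G by (rule comm_group_Inv)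
  interpret h: group_hom G ?S class_map
    using class_map_hom groupS by (intro group_hom.intro group_hom_axioms.intro) (simp_all add: G.group_axioms)
  have carrS: "carrier ?S = {x \<in> \<Pi>\<^sub>E M\<in>\<Delta>. carrier (Cl_loc M). finite {M \<in> \<Delta>. x M \<noteq> \<one>\<^bsub>Cl_loc M\<^esub>}}"
    using group_Cl_loc by (rule carrier_sum_group)
  have step: "f \<in> class_map ` carrier G"
    if "finite F" "f \<in> carrier ?S" "{M \<in> \<Delta>. f M \<noteq> \<one>\<^bsub>Cl_loc M\<^esub>} \<subseteq> F" for F f
    using that
  proof (induct F arbitrary: f rule: finite_induct)
    case empty
    then have "f = \<one>\<^bsub>?S\<^esub>" unfolding carrS one_sum_group by (auto simp: fun_eq_iff restrict_def PiE_iff extensional_def)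
    then show ?case using h.hom_one by (metis G.one_closed image_eqI)
  next
    case (insert M F)
    show ?case
    proof (cases "M \<in> \<Delta>")
      case False
      then show ?thesis using insert by blast
    next
      case M: True
      have M': "M \<in> Max_spec K R" using M by auto
      interpret V: star_domain K "localization K R M" "v_op K (localization K R M)" by (rule star_domain_loc[OF M])
      interpret VG: comm_group "G_loc M" by (rule V.comm_group_Inv)
      have "f M \<in> carrier (Cl_loc M)" using insert.prems(1) M unfolding carrS by (auto simp: PiE_iff)
      then obtain L where L: "L \<in> carrier (G_loc M)" "f M = Prin K (localization K R M) #>\<^bsub>G_loc M\<^esub> L"
        by (auto simp: Cl_star_def FactGroup_def RCOSETS_def)
      obtain I c where I: "I \<in> carrier G" and c: "c \<in> carrier K" "c \<noteq> \<zero>" "v_op K (localization K R M) I = c <#\<^bsub>K\<^esub> L"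
        and IN: "\<And>N. N \<in> Max_spec K R \<Longrightarrow> N \<noteq> M \<Longrightarrow> v_op K (localization K R N) I \<in> Prin K (localization K R N)"
        using single_surj[OF M L(1)] by blast
      \<comment> \<open>Scaling by \<open>c\<close> is multiplication by a principal ideal, so it
        does not change the class.\<close>
      have "c <#\<^bsub>K\<^esub> L \<in> Prin K (localization K R M) #>\<^bsub>G_loc M\<^esub> L" using V.Prin_rcoset[OF L(1)] c by blast
      then have fM: "class_map I M = f M"
        using VG.repr_independence[OF _ L(1) V.subgroup_Prin] M L(2) c(3) by (simp add: class_map_def)
      have fN: "class_map I N = \<one>\<^bsub>Cl_loc N\<^esub>" if "N \<in> \<Delta>" "N \<noteq> M" for N
        using class_map_one_iff[OF I that(1)] IN that by blast
      \<comment> \<open>Dividing \<open>f\<close> by the class of \<open>I\<close> removes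
        \<open>M\<close> from the support and keeps the other coordinates.\<close>
      let ?i = "class_map I" and ?g = "f \<otimes>\<^bsub>?S\<^esub> inv\<^bsub>?S\<^esub> class_map I"
      have iS: "?i \<in> carrier ?S" using I by simp
      have gS: "?g \<in> carrier ?S" using insert.prems(1) iS by (simp del: mult_sum_group)
      have gN: "?g N = f N \<otimes>\<^bsub>Cl_loc N\<^esub> inv\<^bsub>Cl_loc N\<^esub> (?i N)" if "N \<in> \<Delta>" for N
        using inv_sum_group[OF group_Cl_loc iS] that by simp
      have fc: "f N \<in> carrier (Cl_loc N)" if "N \<in> \<Delta>" for N using insert.prems(1) that unfolding carrS by (auto simp: PiE_iff)
      have "?g N = \<one>\<^bsub>Cl_loc N\<^esub>" if N: "N \<in> \<Delta>" "N \<notin> F" for N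
      proof -
        interpret C: group "Cl_loc N" by (rule group_Cl_loc[OF N(1)])
        show ?thesis
        proof (cases "N = M")
          case True
          then show ?thesis using gN[OF N(1)] fM C.r_inv[OF fc[OF N(1)]] by (simp del: mult_sum_group)
        next
          case False
          then have "f N = \<one>\<^bsub>Cl_loc N\<^esub>" using insert.prems(2) N by blast
          then show ?thesis using gN[OF N(1)] fN[OF N(1) False] by simp
        qed
      qed
      then have "?g \<in> class_map ` carrier G" using insert.hyps(3)[OF gS] by blast
      then obtain J where J: "J \<in> carrier G" "?g = class_map J" by blast
      have "f = ?g \<otimes>\<^bsub>?S\<^esub> ?i" using insert.prems(1) iS by (simp add: h.H.m_assoc del: mult_sum_group one_sum_group)
      also have "\<dots> = class_map (J \<otimes>\<^bsub>G\<^esub> I)" using J I by (simp del: mult_sum_group)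
      finally show ?thesis using J I by blast
    qed
  qed
  have "carrier ?S \<subseteq> class_map ` carrier G" using step carrS by blast
  then show ?thesis using h.hom_closed by blast
qed

text \<open>By \<open>Prin_rcoset\<close>, an invertible ideal has the same class, as a set, in both
  groups. So the Picard group is the image of the kernel of \<open>class_map\<close>.\<close>

lemma carrier_Pic: "carrier (Pic K R) = {Prin K R #>\<^bsub>G\<^esub> I | I. I \<in> carrier (Inv_star K R d_op)}"
proof -
  interpret d: star_domain K R d_op by (rule star_domain_d_op)
  have eq: "Prin K R #>\<^bsub>d.G\<^esub> I = Prin K R #>\<^bsub>G\<^esub> I" if "I \<in> carrier d.G" for I
    using d.Prin_rcoset[OF that] Prin_rcoset[of I] that Inv_d_op_subset by (simp add: subset_iff)
  have "carrier (Pic K R) = {Prin K R #>\<^bsub>d.G\<^esub> I | I. I \<in> carrier d.G}"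
    by (auto simp: Pic_def Cl_star_def FactGroup_def RCOSETS_def)
  also have "\<dots> = {Prin K R #>\<^bsub>G\<^esub> I | I. I \<in> carrier d.G}" using eq by blast
  finally show ?thesis .
qed

theorem local_class_group_iso: "local_class_group K R star \<cong> sum_group \<Delta> Cl_loc"
proof -
  interpret d: star_domain K R d_op by (rule star_domain_d_op)
  have "Prin K R \<subseteq> kernel G (sum_group \<Delta> Cl_loc) class_map"
    unfolding kernel_class_map by (rule subgroup.subset[OF d.subgroup_Prin])
  from factor_factor_iso[OF comm_group_Inv sum_group[OF group_Cl_loc] class_map_hom class_map_surj subgroup_Prin this]
  show ?thesis
    unfolding local_class_group_def carrier_Pic kernel_class_map Cl_star_def[of K R star] by simp
qed

end

theorem theorem7p4:
  fixes K :: "('a, 'm) ring_scheme" and R :: "'a set" and star :: "'a set \<Rightarrow> 'a set"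
  assumes "prufer_domain K R"
    and "semilocal K R \<or> (locally_finite K R \<and> finite_dimensional K R)"
    and "star_operation K R star"
  shows "local_class_group K R star \<cong>
    sum_group {M \<in> Max_spec K R. M \<noteq> star M}
      (\<lambda>M. Cl_star K (localization K R M) (v_op K (localization K R M)))"
proof -
  \<comment> \<open>In the semilocal case every set of maximal ideals is finite, so both
    alternatives supply finite character.\<close>
  have "locally_finite K R" using assms(2) by (auto simp: semilocal_def locally_finite_def)
  then interpret lf_prufer_star K R star
    using assms(1,3) unfolding prufer_domain_def domain_with_quotient_field_def
    by (intro lf_prufer_star.intro lf_prufer.intro prufer.intro qdomain.intro star_domain.intro
        qdomain_axioms.intro prufer_axioms.intro lf_prufer_axioms.intro star_domain_axioms.intro) auto
  show ?thesis by (rule local_class_group_iso)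
qed

end
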